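(* Let $G$ be an ultra-quasirandom group (as in the context) and fix $n\ge2$. For each nonempty $F\subseteq\{1,\dots,n\}$ let $A_F$ be a definable subset of $G$ of positive density. Then the set \[\mathcal X_n=\{(a_1,\dots,a_n)\in G^n : a_F\in A_F \text{ for all } \emptyset\neq F\subseteq\{1,\dots,n\}\}\] satisfies $\mu_n(\mathcal X_n)=\prod_F\mu(A_F)$, where $a_F$ is the product of the $a_i$ with $i\in F$, written with the indices in increasing order.
   Context: A finite group is $d$-quasirandom if all its non-trivial representations have degree at least $d$. Let $(G_k)_{k\in\mathbb N}$ be finite groups and $\mathcal U$ a non-principal ultrafilter on $\mathbb N$ such that for every $d\ge1$ the set $\{k: G_k \text{ is } d\text{-quasirandom}\}$ belongs to $\mathcal U$. Regard each $G_k$ as a structure in a countable language $\mathcal L$ expanding the language of groups by predicates $Q_{r,\varphi}(y)$ for every rational $r\ge0$ and $\mathcal L$-formula $\varphi(x,y)$, where $Q_{r,\varphi}(b)$ holds iff $|\varphi(G_k,b)|\le r|G_k|^{|x|}$. Let $G$ be a sufficiently saturated elementary extension of the ultraproduct $\prod_{\mathcal U}G_k$ (called an ultra-quasirandom group). For each $n$, $\mu_n$ denotes the normalized (pseudo-finite) counting measure on the definable subsets of $G^n$: $\mu_n(\varphi(x,b))=\inf\{r\in\mathbb Q^{\ge0}: Q_{r,\varphi}(b)\text{ holds}\}$ for $|x|=n$ (on the ultraproduct itself this is the standard part of the $\mathcal U$-limit of $|\varphi(G_k,b_k)|/|G_k|^n$). Write $\mu=\mu_1$; density means $\mu$-measure.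 *)

theory Defs
  imports
    Complex_Main
    "HOL-Algebra.Group"
    "HOL-Library.Countable_Set"
    "Jordan_Normal_Form.Matrix"
begin

section \<open>Quasirandom groups\<close>

definition quasirandom :: "nat \<Rightarrow> ('a, 'c) monoid_scheme \<Rightarrow> bool" where
  "quasirandom d G \<longleftrightarrow>
     (\<forall>n. \<forall>\<rho> \<in> hom G (units_of (ring_mat TYPE(complex) n ())).
        (\<exists>g \<in> carrier G. \<rho> g \<noteq> 1\<^sub>m n) \<longrightarrow> d \<le> n)"

section \<open>First-order languages expanding the language of groups\<close>

text \<open>
  A signature lists the function and relation symbols other than those of the language
  of groups and the counting predicates (a symbol belongs to the language iff its arity
  is defined). It may be empty.
\<close>

record ('f, 'r) signature =
  fun_ar :: "'f \<Rightarrow> nat option"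
  rel_ar :: "'r \<Rightarrow> nat option"

datatype 'f tm = Var nat | Unit | Prod "'f tm" "'f tm" | Inverse "'f tm" | Fn 'f "'f tm list"

text \<open>
  The symbol \<open>QPred r n m \<phi>\<close> is the predicate \<open>Q\<^sub>r\<^sub>,\<^sub>\<phi>(y)\<close> for the partitioned formula
  \<open>\<phi>(x, y)\<close> in which \<open>x\<close> consists of the variables \<open>0, \<dots>, n - 1\<close> and \<open>y\<close> of the variables
  \<open>n, \<dots>, n + m - 1\<close>. Formulas and relation symbols are mutually recursive because
  \<open>\<phi>\<close> may itself contain counting predicates.
\<close>

datatype ('f, 'r) fm =
    Equal "'f tm" "'f tm"
  | Atom "('f, 'r) relsym" "'f tm list"
  | Neg "('f, 'r) fm"
  | Conj "('f, 'r) fm" "('f, 'r) fm"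
  | Exists nat "('f, 'r) fm"
and ('f, 'r) relsym = Base 'r | QPred rat nat nat "('f, 'r) fm"

primrec fv_tm :: "'f tm \<Rightarrow> nat set" where
  "fv_tm (Var i) = {i}"
| "fv_tm Unit = {}"
| "fv_tm (Prod s t) = fv_tm s \<union> fv_tm t"
| "fv_tm (Inverse t) = fv_tm t"
| "fv_tm (Fn f ts) = \<Union> (set (map fv_tm ts))"

primrec fv :: "('f, 'r) fm \<Rightarrow> nat set" where
  "fv (Equal s t) = fv_tm s \<union> fv_tm t"
| "fv (Atom R ts) = \<Union> (set (map fv_tm ts))"
| "fv (Neg \<phi>) = fv \<phi>"
| "fv (Conj \<phi> \<psi>) = fv \<phi> \<union> fv \<psi>"
| "fv (Exists i \<phi>) = fv \<phi> - {i}"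

primrec wf_tm :: "('f, 'r) signature \<Rightarrow> 'f tm \<Rightarrow> bool" where
  "wf_tm L (Var i) \<longleftrightarrow> True"
| "wf_tm L Unit \<longleftrightarrow> True"
| "wf_tm L (Prod s t) \<longleftrightarrow> wf_tm L s \<and> wf_tm L t"
| "wf_tm L (Inverse t) \<longleftrightarrow> wf_tm L t"
| "wf_tm L (Fn f ts) \<longleftrightarrow> fun_ar L f = Some (length ts) \<and> list_all id (map (wf_tm L) ts)"

text \<open>
  \<open>wf_rel L R k\<close> says that \<open>R\<close> is a \<open>k\<close>-ary relation symbol of the language.
\<close>

primrec wf_fm :: "('f, 'r) signature \<Rightarrow> ('f, 'r) fm \<Rightarrow> bool"
  and wf_rel :: "('f, 'r) signature \<Rightarrow> ('f, 'r) relsym \<Rightarrow> nat \<Rightarrow> bool" where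
  "wf_fm L (Equal s t) \<longleftrightarrow> wf_tm L s \<and> wf_tm L t"
| "wf_fm L (Atom R ts) \<longleftrightarrow> wf_rel L R (length ts) \<and> (\<forall>t \<in> set ts. wf_tm L t)"
| "wf_fm L (Neg \<phi>) \<longleftrightarrow> wf_fm L \<phi>"
| "wf_fm L (Conj \<phi> \<psi>) \<longleftrightarrow> wf_fm L \<phi> \<and> wf_fm L \<psi>"
| "wf_fm L (Exists i \<phi>) \<longleftrightarrow> wf_fm L \<phi>"
| "wf_rel L (Base R) = (\<lambda>k. rel_ar L R = Some k)"
| "wf_rel L (QPred r n m \<phi>) = (\<lambda>k. k = m \<and> 0 \<le> r \<and> wf_fm L \<phi> \<and> fv \<phi> \<subseteq> {..<n + m})"

section \<open>Structures\<close>

record ('a, 'f, 'r) lstruct = "'a monoid" +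
  fun_int :: "'f \<Rightarrow> 'a list \<Rightarrow> 'a"
  rel_int :: "('f, 'r) relsym \<Rightarrow> 'a list \<Rightarrow> bool"

definition group_structure :: "('f, 'r) signature \<Rightarrow> ('a, 'f, 'r) lstruct \<Rightarrow> bool" where
  "group_structure L M \<longleftrightarrow> group M \<and>
     (\<forall>f xs. fun_ar L f = Some (length xs) \<longrightarrow> set xs \<subseteq> carrier M \<longrightarrow>
        fun_int M f xs \<in> carrier M)"

primrec eval_tm :: "('a, 'f, 'r) lstruct \<Rightarrow> (nat \<Rightarrow> 'a) \<Rightarrow> 'f tm \<Rightarrow> 'a" where
  "eval_tm M e (Var i) = e i"
| "eval_tm M e Unit = \<one>\<^bsub>M\<^esub>"
| "eval_tm M e (Prod s t) = eval_tm M e s \<otimes>\<^bsub>M\<^esub> eval_tm M e t"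
| "eval_tm M e (Inverse t) = inv\<^bsub>M\<^esub> (eval_tm M e t)"
| "eval_tm M e (Fn f ts) = fun_int M f (map (eval_tm M e) ts)"

primrec sat :: "('a, 'f, 'r) lstruct \<Rightarrow> (nat \<Rightarrow> 'a) \<Rightarrow> ('f, 'r) fm \<Rightarrow> bool" where
  "sat M e (Equal s t) \<longleftrightarrow> eval_tm M e s = eval_tm M e t"
| "sat M e (Atom R ts) \<longleftrightarrow> rel_int M R (map (eval_tm M e) ts)"
| "sat M e (Neg \<phi>) \<longleftrightarrow> \<not> sat M e \<phi>"
| "sat M e (Conj \<phi> \<psi>) \<longleftrightarrow> sat M e \<phi> \<and> sat M e \<psi>"
| "sat M e (Exists i \<phi>) \<longleftrightarrow> (\<exists>a \<in> carrier M. sat M (e(i := a)) \<phi>)"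

text \<open>Points of \<open>M\<^sup>n\<close> are lists of length \<open>n\<close>.\<close>

definition solutions ::
  "('a, 'f, 'r) lstruct \<Rightarrow> nat \<Rightarrow> ('f, 'r) fm \<Rightarrow> 'a list \<Rightarrow> 'a list set" where
  "solutions M n \<phi> bs =
     {as. length as = n \<and> set as \<subseteq> carrier M \<and> sat M (\<lambda>i. (as @ bs) ! i) \<phi>}"

text \<open>
  This determines the interpretation of the counting predicates from that of the other
  symbols, by recursion on their nesting.
\<close>

definition counting_structure :: "('f, 'r) signature \<Rightarrow> ('a, 'f, 'r) lstruct \<Rightarrow> bool" where
  "counting_structure L M \<longleftrightarrow>
     (\<forall>r n m \<phi> bs. wf_rel L (QPred r n m \<phi>) m \<longrightarrow> length bs = m \<longrightarrow> set bs \<subseteq> carrier M \<longrightarrow>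
        (rel_int M (QPred r n m \<phi>) bs \<longleftrightarrow>
           real (card (solutions M n \<phi> bs)) \<le> real_of_rat r * real (card (carrier M)) ^ n))"

section \<open>Ultraproducts, elementary extensions and saturation\<close>

definition nonprincipal_ultrafilter :: "'i filter \<Rightarrow> bool" where
  "nonprincipal_ultrafilter U \<longleftrightarrow>
     U \<noteq> bot \<and>
     (\<forall>P. eventually P U \<or> eventually (\<lambda>i. \<not> P i) U) \<and>
     (\<forall>i. U \<noteq> principal {i})"

definition ultra_rel :: "'i filter \<Rightarrow> ('i \<Rightarrow> ('a, 'f, 'r) lstruct) \<Rightarrow> (('i \<Rightarrow> 'a) \<times> ('i \<Rightarrow> 'a)) set"
  where
  "ultra_rel U G =
     {(a, b). (\<forall>i. a i \<in> carrier (G i)) \<and> (\<forall>i. b i \<in> carrier (G i)) \<and>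
              eventually (\<lambda>i. a i = b i) U}"

definition ultraproduct ::
  "'i filter \<Rightarrow> ('i \<Rightarrow> ('a, 'f, 'r) lstruct) \<Rightarrow> (('i \<Rightarrow> 'a) set, 'f, 'r) lstruct" where
  "ultraproduct U G =
     (let cls = (\<lambda>a. ultra_rel U G `` {a});
          rep = (\<lambda>X. SOME a. a \<in> X)
      in \<lparr> carrier = {a. \<forall>i. a i \<in> carrier (G i)} // ultra_rel U G,
           mult = (\<lambda>X Y. cls (\<lambda>i. rep X i \<otimes>\<^bsub>G i\<^esub> rep Y i)),
           one = cls (\<lambda>i. \<one>\<^bsub>G i\<^esub>),
           fun_int = (\<lambda>f Xs. cls (\<lambda>i. fun_int (G i) f (map (\<lambda>X. rep X i) Xs))),
           rel_int = (\<lambda>R Xs. eventually (\<lambda>i. rel_int (G i) R (map (\<lambda>X. rep X i) Xs)) U) \<rparr>)"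

definition elementary_embedding ::
  "('f, 'r) signature \<Rightarrow> ('a, 'f, 'r) lstruct \<Rightarrow> ('b, 'f, 'r) lstruct \<Rightarrow> ('a \<Rightarrow> 'b) \<Rightarrow> bool" where
  "elementary_embedding L M N j \<longleftrightarrow>
     j \<in> carrier M \<rightarrow> carrier N \<and>
     (\<forall>\<phi> e. wf_fm L \<phi> \<longrightarrow> range e \<subseteq> carrier M \<longrightarrow> (sat M e \<phi> \<longleftrightarrow> sat N (j \<circ> e) \<phi>))"

text \<open>
  Every 1-type over countably many parameters is realised. In a pair \<open>(\<phi>, e)\<close> the variable
  \<open>0\<close> of \<open>\<phi>\<close> is the variable of the type; \<open>e\<close> supplies the parameters for the other variables.
\<close>

definition aleph1_saturated :: "('f, 'r) signature \<Rightarrow> ('a, 'f, 'r) lstruct \<Rightarrow> bool" where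
  "aleph1_saturated L M \<longleftrightarrow>
     (\<forall>B \<Sigma>. countable B \<longrightarrow> B \<subseteq> carrier M \<longrightarrow>
        (\<forall>(\<phi>, e) \<in> \<Sigma>. wf_fm L \<phi> \<and> range e \<subseteq> B) \<longrightarrow>
        (\<forall>\<Sigma>\<^sub>0 \<subseteq> \<Sigma>. finite \<Sigma>\<^sub>0 \<longrightarrow> (\<exists>a \<in> carrier M. \<forall>(\<phi>, e) \<in> \<Sigma>\<^sub>0. sat M (e(0 := a)) \<phi>)) \<longrightarrow>
        (\<exists>a \<in> carrier M. \<forall>(\<phi>, e) \<in> \<Sigma>. sat M (e(0 := a)) \<phi>))"

definition ultra_quasirandom ::
  "('f, 'r) signature \<Rightarrow> nat filter \<Rightarrow> (nat \<Rightarrow> ('a, 'f, 'r) lstruct) \<Rightarrow>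
   ('b, 'f, 'r) lstruct \<Rightarrow> bool" where
  "ultra_quasirandom L U Gs G \<longleftrightarrow>
     countable (dom (fun_ar L)) \<and> countable (dom (rel_ar L)) \<and>
     (\<forall>k. group_structure L (Gs k) \<and> finite (carrier (Gs k)) \<and> counting_structure L (Gs k)) \<and>
     nonprincipal_ultrafilter U \<and>
     (\<forall>d \<ge> 1. eventually (\<lambda>k. quasirandom d (Gs k)) U) \<and>
     group_structure L G \<and>
     (\<exists>j. elementary_embedding L (ultraproduct U Gs) G j) \<and>
     aleph1_saturated L G"

section \<open>Definable sets and the pseudo-finite counting measure\<close>

definition defined_by ::
  "('f, 'r) signature \<Rightarrow> ('a, 'f, 'r) lstruct \<Rightarrow> nat \<Rightarrow> ('f, 'r) fm \<Rightarrow> 'a list \<Rightarrow> 'a list set \<Rightarrow> bool"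
  where
  "defined_by L M n \<phi> bs X \<longleftrightarrow>
     wf_fm L \<phi> \<and> fv \<phi> \<subseteq> {..<n + length bs} \<and> set bs \<subseteq> carrier M \<and> X = solutions M n \<phi> bs"

definition definable :: "('f, 'r) signature \<Rightarrow> ('a, 'f, 'r) lstruct \<Rightarrow> nat \<Rightarrow> 'a list set \<Rightarrow> bool" where
  "definable L M n X \<longleftrightarrow> (\<exists>\<phi> bs. defined_by L M n \<phi> bs X)"

definition mu_fm :: "('a, 'f, 'r) lstruct \<Rightarrow> nat \<Rightarrow> ('f, 'r) fm \<Rightarrow> 'a list \<Rightarrow> real" where
  "mu_fm M n \<phi> bs = Inf {real_of_rat r | r. 0 \<le> r \<and> rel_int M (QPred r n (length bs) \<phi>) bs}"

text \<open>
  The measure of a definable set is the common value of \<open>mu_fm\<close> at all its definitions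
  (in the structures considered here \<open>mu_fm\<close> depends only on the set defined).
\<close>

definition mu :: "('f, 'r) signature \<Rightarrow> ('a, 'f, 'r) lstruct \<Rightarrow> nat \<Rightarrow> 'a list set \<Rightarrow> real" where
  "mu L M n X = (THE v. definable L M n X \<and> (\<forall>\<phi> bs. defined_by L M n \<phi> bs X \<longrightarrow> v = mu_fm M n \<phi> bs))"

text \<open>A subset of \<open>G\<close> as a subset of \<open>G\<^sup>1\<close>.\<close>

definition pow1 :: "'a set \<Rightarrow> 'a list set" where
  "pow1 A = (\<lambda>a. [a]) ` A"

text \<open>The product \<open>a\<^sub>F\<close>; the entry \<open>a\<^sub>i\<close> (counted from 1) is \<open>as ! (i - 1)\<close>.\<close>

definition index_prod :: "('a, 'c) monoid_scheme \<Rightarrow> 'a list \<Rightarrow> nat set \<Rightarrow> 'a" where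
  "index_prod M as F = foldr (mult M) (map (\<lambda>i. as ! (i - 1)) (sorted_list_of_set F)) \<one>\<^bsub>M\<^esub>"

end

theory Submission
  imports Defs "HOL-Analysis.Function_Topology" "HOL-Analysis.Convex"
begin

text \<open>
  In a finite \<open>d\<close>-quasirandom group, convolution with a mean-zero function \<open>g\<close> contracts the
  \<open>L\<^sup>2\<close> norm by a factor of order \<open>d\<^sup>-\<^sup>1\<^sup>/\<^sup>2\<close>: the functions on which the convolution operator
  attains its norm form a translation invariant space without nonzero constants, hence of dimension
  at least \<open>d\<close>, while the squares of all singular values add up to the squared norm of \<open>g\<close>. So for
  most \<open>x\<close> the set \<open>{y \<in> X. y x \<in> Y}\<close> has density close to the product of the densities of \<open>X\<close> and \<open>Y\<close>.
  Fixing the last coordinate \<open>a\<^sub>n = x\<close> turns the conditions on \<open>a\<^sub>F\<close> and \<open>a\<^sub>F x\<close> into the single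
  condition that \<open>a\<^sub>F\<close> lies in such an intersection; induction on \<open>n\<close> gives the asserted product
  for finite groups up to an error of \<open>2\<^sup>n d\<^sup>-\<^sup>1\<^sup>/\<^sup>2\<close>. For rational bounds on the densities this
  is a family of first-order statements in the counting predicates, which pass to \<open>G\<close> by
  Los's theorem and elementarity.
\<close>

section \<open>Mixing in quasirandom groups\<close>

text \<open>Two obstacles shape the proof. In a finite group an intersection may have the wrong
  density for individual \<open>x\<close>; only the average of the error over \<open>x\<close> is
  controlled, by passing from L2 to L1 with the Cauchy-Schwarz inequality, and an average is all
  that the induction consumes. The factor 2^n arises because each of the fewer than 2^n index sets
  for \<open>n\<close> adds an error d^(-1/2) to the 2^n d^(-1/2) of the induction hypothesis, so
  the constant doubles at each step. In \<open>G\<close> there is nothing to count: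
  \<open>mu_fm\<close> is an infimum of rationals, and parameters need not come from the
  ultraproduct. Each estimate therefore becomes a sentence that binds all parameters, which works
  because the error depends on \<open>n\<close> and \<open>d\<close> alone. A rational
  \<open>t\<close> strictly apart from the product of the rational bounds leaves a gap that absorbs
  the error once \<open>d\<close> is large. The counting predicates express upper bounds; lower
  bounds come from their negations, and positive densities provide the nonnegative rationals below
  them.\<close>

definition ip :: "'a set \<Rightarrow> ('a \<Rightarrow> real) \<Rightarrow> ('a \<Rightarrow> real) \<Rightarrow> real" where
  "ip C f g = (\<Sum>x\<in>C. f x * g x)"

lemma ip_commute: "ip C f g = ip C g f"
  by (simp add: ip_def mult.commute)

lemma ip_diff_left: "ip C (\<lambda>x. f x - g x) h = ip C f h - ip C g h"
  by (simp add: ip_def left_diff_distrib sum_subtractf)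

lemma ip_scale_left: "ip C (\<lambda>x. c * f x) h = c * ip C f h"
  by (simp add: ip_def sum_distrib_left mult.assoc)

lemma ip_scale_right: "ip C f (\<lambda>x. c * h x) = c * ip C f h"
  by (simp add: ip_def sum_distrib_left mult.left_commute)

lemma ip_sum_left: "ip C (\<lambda>x. \<Sum>i\<in>I. f i x) h = (\<Sum>i\<in>I. ip C (f i) h)"
  unfolding ip_def sum_distrib_right by (rule sum.swap)

lemma ip_cong:
  "\<lbrakk>\<And>x. x \<in> C \<Longrightarrow> f x = f' x; \<And>x. x \<in> C \<Longrightarrow> g x = g' x\<rbrakk> \<Longrightarrow> ip C f g = ip C f' g'"
  by (simp add: ip_def)

lemma ip_self_nonneg: "0 \<le> ip C f f"
  by (simp add: ip_def sum_nonneg)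

lemma ip_self_eq_0: "finite C \<Longrightarrow> ip C f f = 0 \<longleftrightarrow> (\<forall>x\<in>C. f x = 0)"
  by (simp add: ip_def sum_nonneg_eq_0_iff)

definition orthonormal :: "'a set \<Rightarrow> nat \<Rightarrow> (nat \<Rightarrow> 'a \<Rightarrow> real) \<Rightarrow> bool" where
  "orthonormal C m e \<longleftrightarrow> (\<forall>i<m. \<forall>j<m. ip C (e i) (e j) = (if i = j then 1 else 0))"

lemma orthonormal_residual:
  assumes "orthonormal C m e" "i < m"
  shows "ip C (\<lambda>x. f x - (\<Sum>j<m. ip C f (e j) * e j x)) (e i) = 0"
proof -
  have "(\<Sum>j<m. ip C f (e j) * ip C (e j) (e i)) = (\<Sum>j<m. if i = j then ip C f (e i) else 0)"
    using assms by (intro sum.cong) (auto simp: orthonormal_def)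
  also have "\<dots> = ip C f (e i)"
    using assms(2) by simp
  finally show ?thesis
    by (simp add: ip_diff_left ip_sum_left ip_scale_left)
qed

text \<open>The residual of the orthogonal projection of \<open>f\<close> has squared norm
  \<open>ip C f f\<close> minus the sum of the squared coefficients, and a squared norm is
  nonnegative.\<close>

lemma bessel:
  assumes "orthonormal C m e"
  shows "(\<Sum>i<m. (ip C f (e i))\<^sup>2) \<le> ip C f f"
proof -
  define r where "r = (\<lambda>x. f x - (\<Sum>j<m. ip C f (e j) * e j x))"
  have re: "ip C r (e i) = 0" if "i < m" for i
    unfolding r_def using orthonormal_residual[OF assms that] .
  have r_left: "ip C r h = ip C f h - (\<Sum>j<m. ip C f (e j) * ip C (e j) h)" for h
    by (simp add: r_def ip_diff_left ip_sum_left ip_scale_left)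
  have "ip C r r = ip C f r - (\<Sum>j<m. ip C f (e j) * ip C (e j) r)"
    by (rule r_left)
  also have "\<dots> = ip C r f"
    using re by (simp add: ip_commute)
  also have "\<dots> = ip C f f - (\<Sum>i<m. (ip C f (e i))\<^sup>2)"
    by (simp add: r_left power2_eq_square ip_commute[of C "e _" f])
  finally show ?thesis
    using ip_self_nonneg[of C r] by simp
qed

text \<open>In the product topology the cube of functions with values in [-1, 1] is compact by
  Tychonoff, and the sphere is a closed part of it: on \<open>C\<close> each squared value is one
  summand of a sum equal to 1, and off \<open>C\<close> the values are fixed to 0.\<close>

lemma compact_unit_sphere:
  fixes C :: "'a set"
  assumes "finite C"
  shows "compact {f :: 'a \<Rightarrow> real. (\<forall>x. x \<notin> C \<longrightarrow> f x = 0) \<and> ip C f f = 1}" (is "compact ?K")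
proof -
  define B where "B = Pi\<^sub>E UNIV (\<lambda>x::'a. {-1..1::real})"
  have "compact B"
    unfolding B_def
    using compactin_PiE[of "\<lambda>_. euclidean" UNIV "\<lambda>x::'a. {-1..1::real}"]
    by (simp add: euclidean_product_topology)
  moreover have "?K = B \<inter> (\<Inter>x\<in>-C. {f. f x = 0}) \<inter> {f. ip C f f = 1}"
  proof -
    have "\<bar>f x\<bar> \<le> 1" if "\<forall>x. x \<notin> C \<longrightarrow> f x = 0" "ip C f f = 1" for f :: "'a \<Rightarrow> real" and x
    proof (cases "x \<in> C")
      case True
      have "f x * f x \<le> ip C f f"
        unfolding ip_def by (rule member_le_sum[OF True]) (use assms in auto)
      then show ?thesis
        using that(2) abs_le_square_iff[of "f x" 1] by (simp add: power2_eq_square)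
    qed (use that in auto)
    then show ?thesis
      by (fastforce simp: B_def PiE_def Pi_def abs_le_iff)
  qed
  moreover have "closed {f :: 'a \<Rightarrow> real. f x = 0}" for x
    by (intro closed_Collect_eq continuous_on_product_coordinates continuous_on_const)
  moreover have "closed {f :: 'a \<Rightarrow> real. ip C f f = 1}"
    unfolding ip_def
    by (intro closed_Collect_eq continuous_on_sum continuous_on_mult
        continuous_on_product_coordinates continuous_on_const)
  ultimately show ?thesis
    by (simp add: compact_Int_closed closed_INT)
qed

text \<open>
  The squared \<open>L\<^sup>2\<close> norm of the image of \<open>f\<close> under the operator with kernel \<open>g (y \<otimes> x)\<close>.
\<close>

definition conv_energy :: "('a, 'c) monoid_scheme \<Rightarrow> ('a \<Rightarrow> real) \<Rightarrow> ('a \<Rightarrow> real) \<Rightarrow> real" where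
  "conv_energy G g f = (\<Sum>x\<in>carrier G. (ip (carrier G) (\<lambda>y. g (y \<otimes>\<^bsub>G\<^esub> x)) f)\<^sup>2)"

lemma conv_energy_scale: "conv_energy G g (\<lambda>x. c * f x) = c\<^sup>2 * conv_energy G g f"
  by (simp add: conv_energy_def ip_scale_right power_mult_distrib sum_distrib_left)

lemma conv_energy_nonneg: "0 \<le> conv_energy G g f"
  by (simp add: conv_energy_def sum_nonneg)

lemma conv_energy_cong:
  "(\<And>x. x \<in> carrier G \<Longrightarrow> f x = f' x) \<Longrightarrow> conv_energy G g f = conv_energy G g f'"
  by (simp add: conv_energy_def ip_def)

text \<open>Together with the same law for \<open>conv_energy\<close>, this will show that the
  functions maximizing the quotient of the two quadratic forms are closed under sums and
  differences.\<close>

lemma parallelogram_ip: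
  "ip C (\<lambda>x. f x + f' x) (\<lambda>x. f x + f' x) + ip C (\<lambda>x. f x - f' x) (\<lambda>x. f x - f' x)
   = 2 * ip C f f + 2 * ip C f' f'"
  by (simp add: ip_def sum.distrib[symmetric] sum_distrib_left algebra_simps)

lemma parallelogram_conv_energy:
  "conv_energy G g (\<lambda>x. f x + f' x) + conv_energy G g (\<lambda>x. f x - f' x)
   = 2 * conv_energy G g f + 2 * conv_energy G g f'"
proof -
  have eq: "ip C h (\<lambda>x. f x + f' x) = ip C h f + ip C h f'"
    "ip C h (\<lambda>x. f x - f' x) = ip C h f - ip C h f'" for C h
    by (simp_all add: ip_def sum.distrib sum_subtractf algebra_simps)
  show ?thesis
    by (simp add: conv_energy_def eq sum.distrib[symmetric] sum_distrib_left power2_eq_square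
        algebra_simps)
qed

section \<open>Translation invariance, matrix representations and the bound on the largest singular
  value\<close>

context group
begin

lemma sum_right_translate:
  assumes "h \<in> carrier G"
  shows "(\<Sum>x\<in>carrier G. f (x \<otimes> h)) = (\<Sum>x\<in>carrier G. f x)"
  by (rule sum.reindex_bij_witness[where i = "\<lambda>x. x \<otimes> inv h" and j = "\<lambda>x. x \<otimes> h"])
    (use assms in \<open>auto simp: m_assoc\<close>)

lemma sum_left_translate:
  assumes "h \<in> carrier G"
  shows "(\<Sum>x\<in>carrier G. f (h \<otimes> x)) = (\<Sum>x\<in>carrier G. f x)"
  by (rule sum.reindex_bij_witness[where i = "\<lambda>x. inv h \<otimes> x" and j = "\<lambda>x. h \<otimes> x"])
    (use assms in \<open>auto simp: m_assoc[symmetric]\<close>)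

lemma ip_right_translate:
  assumes "h \<in> carrier G"
  shows "ip (carrier G) (\<lambda>x. f (x \<otimes> h)) (\<lambda>x. f' (x \<otimes> h)) = ip (carrier G) f f'"
  unfolding ip_def using sum_right_translate[OF assms, of "\<lambda>x. f x * f' x"] .

text \<open>Translating \<open>f\<close> on the right by \<open>h\<close> translates its image under
  the operator on the left, and permuting the points of the group leaves the sum of squares
  unchanged.\<close>

lemma conv_energy_right_translate:
  assumes h: "h \<in> carrier G"
  shows "conv_energy G g (\<lambda>x. f (x \<otimes> h)) = conv_energy G g f"
proof -
  have "ip (carrier G) (\<lambda>y. g (y \<otimes> (h \<otimes> x))) (\<lambda>x. f (x \<otimes> h))
      = ip (carrier G) (\<lambda>y. g (y \<otimes> x)) f" if "x \<in> carrier G" for x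
    using ip_right_translate[OF h, of "\<lambda>y. g (y \<otimes> x)" f] that h
    by (simp add: ip_def m_assoc)
  then show ?thesis
    unfolding conv_energy_def
    using sum_left_translate[OF h, of "\<lambda>x. (ip (carrier G) (\<lambda>y. g (y \<otimes> x)) (\<lambda>x. f (x \<otimes> h)))\<^sup>2"]
    by simp
qed

lemma conv_energy_const:
  assumes "(\<Sum>x\<in>carrier G. g x) = 0" "\<And>x. x \<in> carrier G \<Longrightarrow> f x = c"
  shows "conv_energy G g f = 0"
proof -
  have "ip (carrier G) (\<lambda>y. g (y \<otimes> x)) f = 0" if "x \<in> carrier G" for x
  proof -
    have "ip (carrier G) (\<lambda>y. g (y \<otimes> x)) f = (\<Sum>y\<in>carrier G. g (y \<otimes> x)) * c"
      using assms(2) by (simp add: ip_def sum_distrib_right)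
    then show ?thesis
      using sum_right_translate[OF that, of g] assms(1) by simp
  qed
  then show ?thesis
    by (simp add: conv_energy_def)
qed

text \<open>This is the Hilbert-Schmidt bound. Bessel's inequality is applied to each row of the
  kernel; every row is a right translate of \<open>g\<close>, so each contributes
  \<open>ip (carrier G) g g\<close>.\<close>

lemma conv_energy_orthonormal:
  assumes "finite (carrier G)" "orthonormal (carrier G) m e"
  shows "(\<Sum>i<m. conv_energy G g (e i)) \<le> real (card (carrier G)) * ip (carrier G) g g"
proof -
  have "(\<Sum>i<m. conv_energy G g (e i))
      = (\<Sum>x\<in>carrier G. \<Sum>i<m. (ip (carrier G) (\<lambda>y. g (y \<otimes> x)) (e i))\<^sup>2)"
    unfolding conv_energy_def by (rule sum.swap)
  also have "\<dots> \<le> (\<Sum>x\<in>carrier G. ip (carrier G) (\<lambda>y. g (y \<otimes> x)) (\<lambda>y. g (y \<otimes> x)))"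
    by (intro sum_mono bessel assms)
  also have "\<dots> = (\<Sum>x\<in>carrier G. ip (carrier G) g g)"
    by (intro sum.cong ip_right_translate refl)
  finally show ?thesis by simp
qed

text \<open>
  An orthonormal family whose span is invariant under right translation yields a real matrix
  representation; it is trivial only if its members are constant.
\<close>

lemma quasirandom_orthonormal:
  assumes quasi: "quasirandom d G"
    and on: "orthonormal (carrier G) m e" and m: "0 < m"
    and invariant: "\<And>h j y. \<lbrakk>h \<in> carrier G; j < m; y \<in> carrier G\<rbrakk> \<Longrightarrow>
      e j (y \<otimes> h) = (\<Sum>k<m. ip (carrier G) (\<lambda>y. e j (y \<otimes> h)) (e k) * e k y)"
    and nonconst: "\<And>c. \<exists>y\<in>carrier G. e 0 y \<noteq> c"
  shows "d \<le> m"
proof -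
  let ?C = "carrier G"
  \<comment> \<open>Column \<open>j\<close> holds the coordinates of the right translate of
    \<open>e j\<close>. Translating on the right makes the assignment multiplicative in the given
    order of the factors.\<close>
  define a where "a h i j = ip ?C (\<lambda>y. e j (y \<otimes> h)) (e i)" for h i j
  define \<rho> where "\<rho> h = mat m m (\<lambda>(i, j). complex_of_real (a h i j))" for h
  have a_one: "a \<one> i j = (if i = j then 1 else 0)" if "i < m" "j < m" for i j
  proof -
    have "a \<one> i j = ip ?C (e j) (e i)"
      unfolding a_def by (rule ip_cong) auto
    then show ?thesis
      using on that by (auto simp: orthonormal_def)
  qed
  have a_mult: "a (g \<otimes> h) i j = (\<Sum>k<m. a g i k * a h k j)"
    if "g \<in> ?C" "h \<in> ?C" "j < m" for g h i j
  proof -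
    have "a (g \<otimes> h) i j = ip ?C (\<lambda>y. \<Sum>k<m. a h k j * e k (y \<otimes> g)) (e i)"
      unfolding a_def
    proof (rule ip_cong)
      fix y assume y: "y \<in> ?C"
      then show "e j (y \<otimes> (g \<otimes> h))
          = (\<Sum>k<m. ip ?C (\<lambda>y. e j (y \<otimes> h)) (e k) * e k (y \<otimes> g))"
        using invariant[of h j "y \<otimes> g"] that by (simp add: m_assoc)
    qed simp
    then show ?thesis
      by (simp add: ip_sum_left ip_scale_left mult.commute[of "a g i _"]) (simp add: a_def)
  qed
  have \<rho>_mult: "\<rho> (g \<otimes> h) = \<rho> g * \<rho> h" if "g \<in> ?C" "h \<in> ?C" for g h
    by (rule eq_matI) (auto simp: \<rho>_def scalar_prod_def a_mult[OF that] atLeast0LessThan)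
  have \<rho>_one: "\<rho> \<one> = 1\<^sub>m m"
    by (rule eq_matI) (auto simp: \<rho>_def a_one)
  have \<rho>_carrier: "\<rho> h \<in> carrier_mat m m" for h
    by (simp add: \<rho>_def)
  have "\<rho> h \<in> Units (ring_mat TYPE(complex) m ())" if "h \<in> ?C" for h
    unfolding Units_def
    using that \<rho>_mult[of h "inv h"] \<rho>_mult[of "inv h" h] \<rho>_carrier
    by (auto simp: ring_mat_simps \<rho>_one intro!: bexI[where x = "\<rho> (inv h)"])
  then have hom: "\<rho> \<in> hom G (units_of (ring_mat TYPE(complex) m ()))"
    by (auto simp: hom_def units_of_def ring_mat_simps \<rho>_mult)
  have "\<exists>h\<in>?C. \<rho> h \<noteq> 1\<^sub>m m"
  proof (rule ccontr)
    assume "\<not> ?thesis"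
    then have trivial: "\<rho> h = 1\<^sub>m m" if "h \<in> ?C" for h
      using that by blast
    \<comment> \<open>Evaluating the translate of \<open>e 0\<close> by \<open>h\<close> at the
      neutral element gives \<open>e 0 h\<close>; with identity matrices the expansion of that
      translate is \<open>e 0\<close> itself.\<close>
    have "e 0 h = e 0 \<one>" if h: "h \<in> ?C" for h
    proof -
      have "a h k 0 = (if k = 0 then 1 else 0)" if "k < m" for k
      proof -
        have "complex_of_real (a h k 0) = \<rho> h $$ (k, 0)"
          using that m by (simp add: \<rho>_def)
        also have "\<dots> = (if k = 0 then 1 else 0)"
          using trivial[OF h] that m by simp
        finally show ?thesis
          by (simp split: if_splits)
      qed
      then have "(\<Sum>k<m. a h k 0 * e k \<one>) = (\<Sum>k<m. if k = 0 then e 0 \<one> else 0)"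
        by (intro sum.cong) auto
      then show ?thesis
        using invariant[OF h m one_closed] m h unfolding a_def by simp
    qed
    then show False
      using nonconst by blast
  qed
  then show ?thesis
    using quasi hom unfolding quasirandom_def by blast
qed

text \<open>Compactness yields a maximum on the unit sphere. Both sides of the inequality are
  homogeneous of degree 2, which extends it to all \<open>f\<close>. The value at \<open>v\<close>
  is the square of the largest singular value.\<close>

lemma conv_energy_maximizer:
  assumes fin: "finite (carrier G)"
  obtains v where "ip (carrier G) v v = 1"
    and "\<And>f. conv_energy G g f \<le> conv_energy G g v * ip (carrier G) f f"
proof -
  let ?C = "carrier G"
  define K where "K = {f. (\<forall>x. x \<notin> ?C \<longrightarrow> f x = 0) \<and> ip ?C f f = 1}"
  have "(\<lambda>x. if x = \<one> then 1 else 0) \<in> K"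
    using fin by (auto simp: K_def ip_def if_distrib cong: if_cong)
  moreover have "compact K"
    unfolding K_def by (rule compact_unit_sphere[OF fin])
  moreover have "continuous_on K (conv_energy G g)"
    unfolding conv_energy_def ip_def
    by (intro continuous_on_sum continuous_on_mult continuous_on_power continuous_on_const
        continuous_on_subset[OF continuous_on_product_coordinates] subset_UNIV)
  ultimately obtain v where v: "v \<in> K" "\<And>f. f \<in> K \<Longrightarrow> conv_energy G g f \<le> conv_energy G g v"
    using continuous_attains_sup[of K "conv_energy G g"] by blast
  have "conv_energy G g f \<le> conv_energy G g v * ip ?C f f" for f
  proof (cases "ip ?C f f = 0")
    case True
    then have "conv_energy G g f = conv_energy G g (\<lambda>_. 0)"
      using fin by (intro conv_energy_cong) (simp add: ip_self_eq_0)
    also have "\<dots> = 0"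
      using conv_energy_scale[of G g 0 f] by simp
    finally show ?thesis
      using True by simp
  next
    case False
    define c where "c = sqrt (ip ?C f f)"
    have c: "c > 0" "c\<^sup>2 = ip ?C f f"
      using False ip_self_nonneg[of ?C f] by (auto simp: c_def)
    \<comment> \<open>The sphere \<open>K\<close> asks for functions vanishing off the carrier, so
      the normalized \<open>f\<close> is also cut off there; neither quadratic form sees the
      change.\<close>
    define f' where "f' x = (if x \<in> ?C then 1 / c * f x else 0)" for x
    have "ip ?C f' f' = ip ?C (\<lambda>x. 1 / c * f x) (\<lambda>x. 1 / c * f x)"
      by (rule ip_cong) (auto simp: f'_def)
    also have "\<dots> = 1"
      unfolding ip_scale_left ip_scale_right c(2)[symmetric] using c(1)
      by (simp add: power2_eq_square)
    finally have "f' \<in> K"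
      by (simp add: K_def f'_def)
    moreover have "conv_energy G g f' = conv_energy G g (\<lambda>x. 1 / c * f x)"
      by (rule conv_energy_cong) (auto simp: f'_def)
    ultimately have "(1 / c)\<^sup>2 * conv_energy G g f \<le> conv_energy G g v"
      using v(2)[of f'] conv_energy_scale[of G g "1 / c" f] by simp
    then show ?thesis
      using zero_less_power[OF c(1), of 2] unfolding c(2)
      by (simp add: power_divide c(2) divide_le_eq mult.commute)
  qed
  then show thesis
    using that v(1) by (auto simp: K_def)
qed

lemma quasirandom_mixing:
  assumes fin: "finite (carrier G)" and quasi: "quasirandom d G"
    and mean: "(\<Sum>x\<in>carrier G. g x) = 0"
  shows "real d * conv_energy G g f
    \<le> real (card (carrier G)) * ip (carrier G) g g * ip (carrier G) f f"
proof -
  let ?C = "carrier G" and ?q = "conv_energy G g"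
  obtain v where v: "ip ?C v v = 1" and max: "\<And>f. ?q f \<le> ?q v * ip ?C f f"
    using conv_energy_maximizer[OF fin, of g] by blast
  define l where "l = ?q v"
  \<comment> \<open>The singular space of the largest singular value, described as the set where the
    bound \<open>max\<close> is attained.\<close>
  define E where "E = {f. ?q f = l * ip ?C f f}"
  have add: "(\<lambda>x. f x + f' x) \<in> E" "(\<lambda>x. f x - f' x) \<in> E" if "f \<in> E" "f' \<in> E" for f f'
  proof -
    let ?s = "\<lambda>x. f x + f' x" and ?t = "\<lambda>x. f x - f' x"
    \<comment> \<open>Sum and difference each obey \<open>max\<close>, and the parallelogram laws
      turn the total of the two bounds into an equality, so each bound is attained.\<close>
    have "?q ?s + ?q ?t = l * (ip ?C ?s ?s + ip ?C ?t ?t)"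
      using that parallelogram_conv_energy[of G g f f'] parallelogram_ip[of ?C f f']
      by (simp add: E_def algebra_simps)
    then show "?s \<in> E" "?t \<in> E"
      using max[of ?s] max[of ?t] unfolding E_def mem_Collect_eq l_def distrib_left by linarith+
  qed
  have scale: "(\<lambda>x. c * f x) \<in> E" if "f \<in> E" for c f
    using that by (simp add: E_def conv_energy_scale ip_scale_left
        ip_scale_right power2_eq_square)
  have sum: "(\<lambda>x. \<Sum>k<m. c k * e k x) \<in> E" if "\<And>k. k < m \<Longrightarrow> e k \<in> E" for m :: nat and c e
    using that
  proof (induction m)
    case 0
    show ?case
      using scale[of v 0] by (simp add: E_def l_def v)
  next
    case (Suc m)
    then show ?case
      using add(1)[of "\<lambda>x. \<Sum>k<m. c k * e k x" "\<lambda>x. c m * e m x"] scale by simp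
  qed
  have translate: "(\<lambda>y. f (y \<otimes> h)) \<in> E" if "f \<in> E" "h \<in> ?C" for f h
    using that by (simp add: E_def conv_energy_right_translate ip_right_translate)
  have bound: "real m * l \<le> real (card ?C) * ip ?C g g"
    if "orthonormal ?C m e" "\<And>i. i < m \<Longrightarrow> e i \<in> E" for m e
  proof -
    have "(\<Sum>i<m. ?q (e i)) = (\<Sum>i<m. l)"
      using that by (intro sum.cong) (auto simp: E_def orthonormal_def)
    then show ?thesis
      using conv_energy_orthonormal[OF fin that(1), of g] by simp
  qed
  have "real d * l \<le> real (card ?C) * ip ?C g g"
  proof (cases "l > 0")
    case False
    then have "l = 0"
      using conv_energy_nonneg[of G g v] by (simp add: l_def)
    then show ?thesis
      by (simp add: ip_self_nonneg)
  next
    case True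
    \<comment> \<open>\<open>bound\<close> limits the size of an orthonormal family in
      \<open>E\<close> because \<open>l\<close> is positive. A family of the largest size plays the
      part of a basis of \<open>E\<close>.\<close>
    define P where "P m \<longleftrightarrow> (\<exists>e. orthonormal ?C m e \<and> (\<forall>i<m. e i \<in> E))" for m
    have "P 1"
      unfolding P_def orthonormal_def by (rule exI[of _ "\<lambda>_. v"]) (simp add: v E_def l_def)
    moreover have "\<forall>m. P m \<longrightarrow> m \<le> nat \<lceil>real (card ?C) * ip ?C g g / l\<rceil>"
    proof (intro allI impI)
      fix m assume "P m"
      then have "real m * l \<le> real (card ?C) * ip ?C g g"
        using bound by (auto simp: P_def)
      then have "real m \<le> real (card ?C) * ip ?C g g / l"
        using True by (simp add: pos_le_divide_eq)
      then show "m \<le> nat \<lceil>real (card ?C) * ip ?C g g / l\<rceil>"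
        using real_nat_ceiling_ge[of "real (card ?C) * ip ?C g g / l"] by linarith
    qed
    ultimately obtain m where m: "P m" "\<And>k. P k \<Longrightarrow> k \<le> m"
      using Nat.ex_has_greatest_nat[of P 1 "nat \<lceil>real (card ?C) * ip ?C g g / l\<rceil>"] by auto
    obtain e where e: "orthonormal ?C m e" "\<And>i. i < m \<Longrightarrow> e i \<in> E"
      using m(1) by (auto simp: P_def)
    have m_pos: "0 < m"
      using m(2)[OF \<open>P 1\<close>] by simp
    \<comment> \<open>A function of \<open>E\<close> with nonzero residual would give one more
      orthonormal member after normalization, against the maximality of \<open>m\<close>.\<close>
    have expand: "f y = (\<Sum>k<m. ip ?C f (e k) * e k y)" if f: "f \<in> E" and y: "y \<in> ?C" for f y
    proof (rule ccontr)
      assume neq: "\<not> ?thesis"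
      define r where "r x = f x - (\<Sum>k<m. ip ?C f (e k) * e k x)" for x
      have r: "r \<in> E"
        unfolding r_def by (intro add(2) f sum e(2))
      have "ip ?C r r \<noteq> 0"
        using neq y by (auto simp: ip_self_eq_0[OF fin] r_def)
      then have pos: "ip ?C r r > 0"
        using ip_self_nonneg[of ?C r] by simp
      define c where "c = 1 / sqrt (ip ?C r r)"
      have c: "c * (c * ip ?C r r) = 1"
        using pos by (simp add: c_def)
      define e' where "e' = e(m := (\<lambda>x. c * r x))"
      have re: "ip ?C r (e i) = 0" if "i < m" for i
        unfolding r_def using orthonormal_residual[OF e(1) that] .
      have "orthonormal ?C (Suc m) e'"
        using e(1) re c unfolding orthonormal_def e'_def
        by (auto simp: less_Suc_eq ip_scale_left ip_scale_right ip_commute[of ?C "e _" r])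
      moreover have "\<forall>i<Suc m. e' i \<in> E"
        using e(2) scale[OF r] by (auto simp: e'_def less_Suc_eq)
      ultimately have "P (Suc m)"
        by (auto simp: P_def)
      then show False
        using m(2) by fastforce
    qed
    have "d \<le> m"
    proof (rule quasirandom_orthonormal[OF quasi e(1) m_pos])
      fix h j y assume "h \<in> ?C" "j < m" "y \<in> ?C"
      then show "e j (y \<otimes> h) = (\<Sum>k<m. ip ?C (\<lambda>y. e j (y \<otimes> h)) (e k) * e k y)"
        using expand[OF translate[OF e(2)]] by blast
    next
      fix c
      show "\<exists>y\<in>?C. e 0 y \<noteq> c"
      proof (rule ccontr)
        assume "\<not> ?thesis"
        \<comment> \<open>The mean-zero \<open>g\<close> annihilates constants, whereas every unit
          vector of \<open>E\<close> has energy \<open>l\<close>.\<close>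
        then have "?q (e 0) = 0"
          using conv_energy_const[OF mean] by blast
        moreover have "?q (e 0) = l"
          using e m_pos by (auto simp: E_def orthonormal_def)
        ultimately show False
          using True by simp
      qed
    qed
    then have "real d * l \<le> real m * l"
      using True by simp
    then show ?thesis
      using bound[OF e] by simp
  qed
  then have "real d * l * ip ?C f f \<le> real (card ?C) * ip ?C g g * ip ?C f f"
    using ip_self_nonneg by (rule mult_right_mono)
  moreover have "real d * ?q f \<le> real d * (l * ip ?C f f)"
    using max[of f] by (simp add: l_def mult_left_mono)
  ultimately show ?thesis
    by (simp add: mult.assoc)
qed

end

section \<open>Counting tuples with prescribed products\<close>

definition density :: "('a, 'c) monoid_scheme \<Rightarrow> 'a set \<Rightarrow> real" where
  "density G X = real (card X) / real (card (carrier G))"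

definition index_sets :: "nat \<Rightarrow> nat set set" where
  "index_sets n = {F. F \<noteq> {} \<and> F \<subseteq> {1..n}}"

definition product_tuples :: "('a, 'c) monoid_scheme \<Rightarrow> nat \<Rightarrow> (nat set \<Rightarrow> 'a set) \<Rightarrow> 'a list set" where
  "product_tuples G n A =
     {as. length as = n \<and> set as \<subseteq> carrier G \<and> (\<forall>F \<in> index_sets n. index_prod G as F \<in> A F)}"

lemma finite_index_sets: "finite (index_sets n)"
  by (simp add: index_sets_def)

lemma index_sets_0: "index_sets 0 = {}"
  by (auto simp: index_sets_def)

text \<open>Sets with and without the new index come in pairs, except that \<open>{Suc n}\<close>
  stands alone: its partner would be the empty set, which is not an index set.\<close>

lemma index_sets_Suc:
  "index_sets (Suc n) = insert {Suc n} (index_sets n \<union> insert (Suc n) ` index_sets n)"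
proof (intro equalityI subsetI)
  fix F assume F: "F \<in> index_sets (Suc n)"
  show "F \<in> insert {Suc n} (index_sets n \<union> insert (Suc n) ` index_sets n)"
  proof (cases "Suc n \<in> F")
    case True
    then obtain F' where "F = insert (Suc n) F'" "Suc n \<notin> F'"
      by (rule mk_disjoint_insert[THEN exE]) auto
    then show ?thesis
      using F by (cases "F' = {}") (auto simp: index_sets_def atLeastAtMostSuc_conv)
  next
    case False
    then show ?thesis
      using F by (auto simp: index_sets_def atLeastAtMostSuc_conv)
  qed
qed (auto simp: index_sets_def)

lemma Suc_notin_index_sets: "F \<in> index_sets n \<Longrightarrow> Suc n \<notin> F"
  by (auto simp: index_sets_def)

lemma prod_index_sets_Suc:
  fixes f :: "nat set \<Rightarrow> real"
  shows "(\<Prod>F\<in>index_sets (Suc n). f F)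
    = f {Suc n} * (\<Prod>F\<in>index_sets n. f F * f (insert (Suc n) F))"
proof -
  have "inj_on (insert (Suc n)) (index_sets n)"
    by (rule inj_onI) (metis Suc_notin_index_sets insert_ident)
  then have "(\<Prod>F\<in>insert (Suc n) ` index_sets n. f F) = (\<Prod>F\<in>index_sets n. f (insert (Suc n) F))"
    by (simp add: prod.reindex)
  moreover have "index_sets n \<inter> insert (Suc n) ` index_sets n = {}"
    by (auto simp: index_sets_def)
  moreover have "{Suc n} \<notin> index_sets n \<union> insert (Suc n) ` index_sets n"
    by (auto simp: index_sets_def)
  ultimately show ?thesis
    by (simp add: index_sets_Suc finite_index_sets prod.union_disjoint prod.distrib)
qed

lemma card_index_sets_le: "real (card (index_sets n)) \<le> 2 ^ n"
proof -
  have "card (index_sets n) \<le> card (Pow {1..n})"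
    by (intro card_mono) (auto simp: index_sets_def)
  then show ?thesis
    by (simp add: card_Pow)
qed

section \<open>Products of coordinates and the induction on their number\<close>

context group
begin

lemma foldr_mult_closed:
  "set xs \<subseteq> carrier G \<Longrightarrow> z \<in> carrier G \<Longrightarrow> foldr (\<otimes>) xs z \<in> carrier G"
  by (induction xs) auto

lemma foldr_mult_eq:
  "set xs \<subseteq> carrier G \<Longrightarrow> z \<in> carrier G \<Longrightarrow> foldr (\<otimes>) xs z = foldr (\<otimes>) xs \<one> \<otimes> z"
  by (induction xs) (auto simp: m_assoc foldr_mult_closed)

lemma index_prod_append:
  assumes "F \<subseteq> {1..length as}"
  shows "index_prod G (as @ bs) F = index_prod G as F"
proof -
  have "finite F"
    using assms finite_subset by blast
  moreover have "i - 1 < length as" if "i \<in> F" for i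
    using assms that by force
  ultimately have "map (\<lambda>i. (as @ bs) ! (i - 1)) (sorted_list_of_set F)
      = map (\<lambda>i. as ! (i - 1)) (sorted_list_of_set F)"
    by (intro map_cong) (auto simp: nth_append)
  then show ?thesis
    unfolding index_prod_def by (simp only:)
qed

text \<open>Factors stand in increasing order of their indices, so the largest index supplies the
  last factor. This is why the induction removes the last coordinate. The new entry has list
  position \<open>length as\<close>, hence index \<open>Suc (length as)\<close>.\<close>

lemma index_prod_snoc:
  assumes F: "F \<subseteq> {1..length as}" and as: "set as \<subseteq> carrier G" and x: "x \<in> carrier G"
  shows "index_prod G (as @ [x]) (insert (Suc (length as)) F) = index_prod G as F \<otimes> x"
proof -
  have fin: "finite F"
    using F finite_subset by blast
  have sorted: "sorted_list_of_set (insert (Suc (length as)) F) = sorted_list_of_set F @ [Suc (length as)]"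
    by (rule sorted_distinct_set_unique) (use F fin in \<open>auto simp: sorted_append simp del: sorted_list_of_set_insert_remove\<close>)
  have "i - 1 < length as" if "i \<in> F" for i
    using F that by force
  then have eq: "map (\<lambda>i. (as @ [x]) ! (i - 1)) (sorted_list_of_set F)
      = map (\<lambda>i. as ! (i - 1)) (sorted_list_of_set F)" (is "_ = ?xs")
    using fin by (intro map_cong) (auto simp: nth_append)
  have "index_prod G (as @ [x]) (insert (Suc (length as)) F)
      = foldr (\<otimes>) (map (\<lambda>i. (as @ [x]) ! (i - 1)) (sorted_list_of_set F)) x"
    using x by (simp add: index_prod_def sorted)
  also have "\<dots> = foldr (\<otimes>) ?xs x"
    unfolding eq ..
  also have "\<dots> = index_prod G as F \<otimes> x"
    unfolding index_prod_def by (rule foldr_mult_eq) (use F as x fin in \<open>auto simp: subset_iff\<close>)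
  finally show ?thesis .
qed

lemma density_bounds:
  assumes "finite (carrier G)" "X \<subseteq> carrier G"
  shows "0 \<le> density G X" "density G X \<le> 1"
proof -
  show "0 \<le> density G X"
    by (simp add: density_def)
  have "card X \<le> card (carrier G)"
    using assms by (intro card_mono)
  then show "density G X \<le> 1"
    by (auto simp: density_def divide_le_eq_1)
qed

lemma quasirandom_intersections:
  assumes fin: "finite (carrier G)" and quasi: "quasirandom d G" and d: "0 < d"
    and X: "X \<subseteq> carrier G" and Y: "Y \<subseteq> carrier G"
  shows "(\<Sum>x\<in>carrier G. \<bar>density G {y \<in> X. y \<otimes> x \<in> Y} - density G X * density G Y\<bar>)
    \<le> real (card (carrier G)) / sqrt (real d)"
proof -
  let ?C = "carrier G"
  define N where "N = real (card ?C)"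
  have N: "N > 0"
    using fin by (auto simp: N_def card_gt_0_iff)
  define \<delta> where "\<delta> x = density G {y \<in> X. y \<otimes> x \<in> Y} - density G X * density G Y" for x
  define f where "f y = (if y \<in> X then 1 else 0 :: real)" for y
  \<comment> \<open>Subtracting the density gives mean zero; tested against the indicator of
    \<open>X\<close>, the translate of \<open>g\<close> by \<open>x\<close> then counts exactly the
    deviation \<open>\<delta> x\<close>, scaled by the group order.\<close>
  define g where "g y = (if y \<in> Y then 1 else 0) - density G Y" for y
  have count: "(\<Sum>y\<in>?C. if y \<in> Z then 1 else 0) = real (card Z)" if "Z \<subseteq> ?C" for Z
    using fin that by (simp add: sum.If_cases inf.absorb2)
  have mean: "(\<Sum>y\<in>?C. g y) = 0"
    using N count[OF Y] by (simp add: g_def sum_subtractf density_def N_def)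
  have "ip ?C (\<lambda>y. g (y \<otimes> x)) f = N * \<delta> x" if "x \<in> ?C" for x
  proof -
    have "ip ?C (\<lambda>y. g (y \<otimes> x)) f
        = (\<Sum>y\<in>?C. (if y \<in> {y \<in> X. y \<otimes> x \<in> Y} then 1 else 0) - density G Y * (if y \<in> X then 1 else 0))"
      unfolding ip_def by (rule sum.cong) (auto simp: f_def g_def)
    also have "\<dots> = real (card {y \<in> X. y \<otimes> x \<in> Y}) - density G Y * real (card X)"
      using count[of "{y \<in> X. y \<otimes> x \<in> Y}"] count[OF X] X
      unfolding sum_subtractf sum_distrib_left[symmetric] by auto
    also have "\<dots> = N * \<delta> x"
      using N unfolding \<delta>_def density_def N_def[symmetric] by (simp add: right_diff_distrib)
    finally show ?thesis .
  qed
  then have energy: "conv_energy G g f = N\<^sup>2 * (\<Sum>x\<in>?C. (\<delta> x)\<^sup>2)"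
    by (simp add: conv_energy_def power_mult_distrib sum_distrib_left)
  have le_N: "ip ?C h h \<le> N" if "\<And>y. \<bar>h y\<bar> \<le> 1" for h
  proof -
    have "ip ?C h h \<le> (\<Sum>y\<in>?C. 1)"
      unfolding ip_def
      using that by (intro sum_mono) (simp add: abs_square_le_1 flip: power2_eq_square)
    then show ?thesis
      by (simp add: N_def)
  qed
  \<comment> \<open>Bounding both squared norms by the group order keeps the error independent of
    \<open>X\<close> and \<open>Y\<close>, hence later of the parameters.\<close>
  have "\<bar>g y\<bar> \<le> 1" "\<bar>f y\<bar> \<le> 1" for y
    using density_bounds[OF fin Y] by (auto simp: g_def f_def)
  then have "N * ip ?C g g * ip ?C f f \<le> N * N * N"
    using N by (intro mult_mono le_N) (simp_all add: ip_self_nonneg)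
  then have "real d * (N\<^sup>2 * (\<Sum>x\<in>?C. (\<delta> x)\<^sup>2)) \<le> N * N * N"
    using quasirandom_mixing[OF fin quasi mean, of f] by (simp add: energy N_def)
  then have "N\<^sup>2 * (real d * (\<Sum>x\<in>?C. (\<delta> x)\<^sup>2)) \<le> N\<^sup>2 * N"
    by (simp only: power2_eq_square mult.left_commute[of "real d"])
  then have "real d * (\<Sum>x\<in>?C. (\<delta> x)\<^sup>2) \<le> N"
    by (rule mult_left_le_imp_le) (use N in simp)
  then have "(\<Sum>x\<in>?C. (\<delta> x)\<^sup>2) \<le> N / real d"
    using d by (simp add: pos_le_divide_eq mult.commute)
  then have "N * (\<Sum>x\<in>?C. (\<delta> x)\<^sup>2) \<le> N * (N / real d)"
    using N by (rule mult_left_mono[OF _ less_imp_le])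
  \<comment> \<open>The Cauchy-Schwarz inequality against the constant 1 passes from the quadratic
    mean to the average of the deviations.\<close>
  moreover have "(\<Sum>x\<in>?C. \<bar>\<delta> x\<bar>)\<^sup>2 \<le> N * (\<Sum>x\<in>?C. (\<delta> x)\<^sup>2)"
    using sum_squared_le_sum_of_squares[of "\<lambda>x. \<bar>\<delta> x\<bar>" ?C] by (simp add: N_def mult.commute)
  moreover have "(N / sqrt (real d))\<^sup>2 = N * (N / real d)"
    by (simp add: power_divide) (simp add: power2_eq_square)
  ultimately have "(\<Sum>x\<in>?C. \<bar>\<delta> x\<bar>)\<^sup>2 \<le> (N / sqrt (real d))\<^sup>2"
    by linarith
  then show ?thesis
    unfolding N_def[symmetric] \<delta>_def[symmetric]
    by (rule power2_le_imp_le) (use N in simp)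
qed

lemma card_product_tuples_Suc:
  assumes fin: "finite (carrier G)" and A: "\<And>F. A F \<subseteq> carrier G"
  shows "card (product_tuples G (Suc n) A)
    = (\<Sum>x\<in>A {Suc n}. card (product_tuples G n (\<lambda>F. {y \<in> A F. y \<otimes> x \<in> A (insert (Suc n) F)})))"
    (is "_ = (\<Sum>x\<in>_. card (?S x))")
proof -
  have iff: "as @ [x] \<in> product_tuples G (Suc n) A \<longleftrightarrow> x \<in> A {Suc n} \<and> as \<in> ?S x"
    if "length as = n" for as x
  proof (cases "set as \<subseteq> carrier G \<and> x \<in> carrier G")
    case True
    have sub: "F \<subseteq> {1..length as}" if "F \<in> index_sets n" for F
      using that \<open>length as = n\<close> by (simp add: index_sets_def)
    have "index_prod G (as @ [x]) {Suc n} = x"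
      using index_prod_snoc[of "{}" as x] True that by (simp add: index_prod_def)
    moreover have "index_prod G (as @ [x]) (insert (Suc n) F) = index_prod G as F \<otimes> x"
      if "F \<in> index_sets n" for F
      using index_prod_snoc[OF sub[OF that]] True \<open>length as = n\<close> by simp
    moreover have "index_prod G (as @ [x]) F = index_prod G as F" if "F \<in> index_sets n" for F
      using index_prod_append[OF sub[OF that]] .
    ultimately have "(\<forall>F\<in>index_sets (Suc n). index_prod G (as @ [x]) F \<in> A F) \<longleftrightarrow>
        x \<in> A {Suc n} \<and> (\<forall>F\<in>index_sets n. index_prod G as F \<in> A F) \<and>
        (\<forall>F\<in>index_sets n. index_prod G as F \<otimes> x \<in> A (insert (Suc n) F))"
      by (simp add: index_sets_Suc ball_Un cong: ball_cong)
    then show ?thesis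
      using True that by (auto simp: product_tuples_def)
  next
    case False
    then show ?thesis
      using A[of "{Suc n}"] that by (auto simp: product_tuples_def)
  qed
  \<comment> \<open>A tuple determines its last entry, so this union is disjoint and the
    cardinalities add.\<close>
  have "product_tuples G (Suc n) A = (\<Union>x\<in>A {Suc n}. (\<lambda>as. as @ [x]) ` ?S x)"
  proof (intro equalityI subsetI)
    fix bs assume bs: "bs \<in> product_tuples G (Suc n) A"
    then obtain as x where "bs = as @ [x]" "length as = n"
      by (cases bs rule: rev_cases) (auto simp: product_tuples_def)
    then show "bs \<in> (\<Union>x\<in>A {Suc n}. (\<lambda>as. as @ [x]) ` ?S x)"
      using bs iff by blast
  next
    fix bs assume "bs \<in> (\<Union>x\<in>A {Suc n}. (\<lambda>as. as @ [x]) ` ?S x)"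
    then obtain as x where "bs = as @ [x]" "x \<in> A {Suc n}" "as \<in> ?S x"
      by blast
    moreover from this have "length as = n"
      by (simp add: product_tuples_def)
    ultimately show "bs \<in> product_tuples G (Suc n) A"
      using iff by simp
  qed
  moreover have "finite (?S x)" for x
    by (rule finite_subset[OF _ finite_lists_length_eq[OF fin, of n]])
      (auto simp: product_tuples_def)
  moreover have "finite (A {Suc n})"
    using A fin finite_subset by blast
  moreover have "card ((\<lambda>as. as @ [x]) ` ?S x) = card (?S x)" for x
    by (rule card_image) (simp add: inj_on_def)
  ultimately show ?thesis
    by (simp only:) (subst card_UN_disjoint, auto)
qed

lemma quasirandom_product_tuples:
  assumes fin: "finite (carrier G)" and quasi: "quasirandom d G" and d: "0 < d"
    and A: "\<And>F. A F \<subseteq> carrier G"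
  shows "\<bar>real (card (product_tuples G n A)) / real (card (carrier G)) ^ n
      - (\<Prod>F\<in>index_sets n. density G (A F))\<bar> \<le> 2 ^ n / sqrt (real d)"
  using A
proof (induction n arbitrary: A)
  case 0
  have "product_tuples G 0 A = {[]}"
    by (auto simp: product_tuples_def index_sets_0)
  then show ?case
    by (simp add: index_sets_0)
next
  case (Suc n)
  let ?C = "carrier G"
  define N where "N = real (card ?C)"
  have N: "N > 0"
    using fin by (auto simp: N_def card_gt_0_iff)
  define \<epsilon> where "\<epsilon> = 2 ^ n / sqrt (real d)"
  let ?Z = "A {Suc n}"
  define B where "B x F = {y \<in> A F. y \<otimes> x \<in> A (insert (Suc n) F)}" for x F
  define p where "p F = density G (A F) * density G (A (insert (Suc n) F))" for F
  define c where "c x = real (card (product_tuples G n (B x))) / N ^ n" for x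
  have B: "B x F \<subseteq> ?C" for x F
    using Suc.prems by (auto simp: B_def)
  have p: "\<bar>p F\<bar> \<le> 1" for F
    using density_bounds[OF fin Suc.prems] by (simp add: p_def abs_mult mult_le_one)
  \<comment> \<open>The induction hypothesis compares the fibre with the densities of the sets
    \<open>B x F\<close>. Replacing these by \<open>p F\<close> one factor at a time costs the sum
    of the differences, because all factors lie in [-1, 1].\<close>
  have step: "\<bar>c x - (\<Prod>F\<in>index_sets n. p F)\<bar>
      \<le> \<epsilon> + (\<Sum>F\<in>index_sets n. \<bar>density G (B x F) - p F\<bar>)" for x
  proof -
    have "\<bar>c x - (\<Prod>F\<in>index_sets n. density G (B x F))\<bar> \<le> \<epsilon>"
      unfolding c_def \<epsilon>_def N_def by (rule Suc.IH) (rule B)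
    moreover have "\<bar>(\<Prod>F\<in>index_sets n. density G (B x F)) - (\<Prod>F\<in>index_sets n. p F)\<bar>
        \<le> (\<Sum>F\<in>index_sets n. \<bar>density G (B x F) - p F\<bar>)"
      using norm_prod_diff[of "index_sets n" "\<lambda>F. density G (B x F)" p] p density_bounds[OF fin B]
      by simp
    ultimately show ?thesis by linarith
  qed
  have card_eq: "real (card (product_tuples G (Suc n) A)) / N ^ Suc n = (\<Sum>x\<in>?Z. c x) / N"
    unfolding card_product_tuples_Suc[OF fin Suc.prems] B_def[symmetric, abs_def] c_def
    by (simp add: sum_divide_distrib mult.commute)
  have prod_eq: "(\<Prod>F\<in>index_sets (Suc n). density G (A F)) = (\<Sum>x\<in>?Z. \<Prod>F\<in>index_sets n. p F) / N"
    by (simp add: prod_index_sets_Suc p_def density_def[of G ?Z] N_def)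
  have "\<bar>(\<Sum>x\<in>?Z. c x) - (\<Sum>x\<in>?Z. \<Prod>F\<in>index_sets n. p F)\<bar>
      \<le> (\<Sum>x\<in>?Z. \<bar>c x - (\<Prod>F\<in>index_sets n. p F)\<bar>)"
    unfolding sum_subtractf[symmetric] by (rule sum_abs)
  also have "\<dots> \<le> (\<Sum>x\<in>?Z. \<epsilon> + (\<Sum>F\<in>index_sets n. \<bar>density G (B x F) - p F\<bar>))"
    by (intro sum_mono step)
  \<comment> \<open>The terms are nonnegative, so the sum may be extended to the whole group, where
    the averaged estimate for intersections applies.\<close>
  also have "\<dots> \<le> (\<Sum>x\<in>?C. \<epsilon> + (\<Sum>F\<in>index_sets n. \<bar>density G (B x F) - p F\<bar>))"
    by (intro sum_mono2 fin Suc.prems) (auto intro!: add_nonneg_nonneg sum_nonneg simp: \<epsilon>_def)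
  also have "\<dots> = N * \<epsilon> + (\<Sum>F\<in>index_sets n. \<Sum>x\<in>?C. \<bar>density G (B x F) - p F\<bar>)"
    unfolding sum.distrib by (subst sum.swap) (simp add: N_def)
  also have "\<dots> \<le> N * \<epsilon> + (\<Sum>F\<in>index_sets n. N / sqrt (real d))"
    unfolding B_def p_def N_def
    by (rule add_left_mono, rule sum_mono, rule quasirandom_intersections[OF fin quasi d])
      (rule Suc.prems)+
  also have "\<dots> = N * \<epsilon> + real (card (index_sets n)) * (N / sqrt (real d))"
    by simp
  also have "\<dots> \<le> N * \<epsilon> + 2 ^ n * (N / sqrt (real d))"
    using N by (intro add_left_mono mult_right_mono card_index_sets_le) auto
  also have "\<dots> = N * (2 ^ Suc n / sqrt (real d))"
    by (simp add: \<epsilon>_def)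
  finally have "\<bar>(\<Sum>x\<in>?Z. c x) - (\<Sum>x\<in>?Z. \<Prod>F\<in>index_sets n. p F)\<bar> / N \<le> 2 ^ Suc n / sqrt (real d)"
    using N by (simp add: divide_le_eq mult.commute)
  then show ?case
    unfolding N_def[symmetric] card_eq prod_eq diff_divide_distrib[symmetric]
    using N by simp
qed

end

section \<open>Renaming and derived connectives\<close>

text \<open>The datatype is mutually recursive through \<open>QPred\<close>. Taking a trivial
  predicate for relation symbols makes the formula inside a counting predicate opaque, part of the
  name of the symbol.\<close>

lemma fm_induct [case_names Equal Atom Neg Conj Exists]:
  assumes "\<And>s t. P (Equal s t)" "\<And>R ts. P (Atom R ts)" "\<And>\<phi>. P \<phi> \<Longrightarrow> P (Neg \<phi>)"
    and "\<And>\<phi> \<psi>. \<lbrakk>P \<phi>; P \<psi>\<rbrakk> \<Longrightarrow> P (Conj \<phi> \<psi>)" "\<And>i \<phi>. P \<phi> \<Longrightarrow> P (Exists i \<phi>)"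
  shows "P (\<phi> :: ('f, 'r) fm)"
  by (rule fm.induct[where ?P1.0 = P and ?P2.0 = "\<lambda>_. True"]) (use assms in auto)

lemma finite_fv_tm: "finite (fv_tm t)"
  by (induction t) auto

lemma finite_fv: "finite (fv \<phi>)"
  by (induction \<phi> rule: fm_induct) (auto simp: finite_fv_tm)

lemma eval_tm_cong: "(\<And>v. v \<in> fv_tm t \<Longrightarrow> e v = e' v) \<Longrightarrow> eval_tm M e t = eval_tm M e' t"
proof (induction t)
  case (Fn f ts)
  then have "map (eval_tm M e) ts = map (eval_tm M e') ts"
    by (intro map_cong) auto
  then show ?case
    by (simp only: eval_tm.simps)
next
  case (Prod s t)
  then have "eval_tm M e s = eval_tm M e' s" "eval_tm M e t = eval_tm M e' t"
    by auto
  then show ?case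
    by simp
qed auto

lemma sat_cong: "(\<And>v. v \<in> fv \<phi> \<Longrightarrow> e v = e' v) \<Longrightarrow> sat M e \<phi> \<longleftrightarrow> sat M e' \<phi>"
proof (induction \<phi> arbitrary: e e' rule: fm_induct)
  case (Equal s t)
  then have "eval_tm M e s = eval_tm M e' s" "eval_tm M e t = eval_tm M e' t"
    by (auto intro: eval_tm_cong)
  then show ?case
    by simp
next
  case (Atom R ts)
  then have "map (eval_tm M e) ts = map (eval_tm M e') ts"
    by (intro map_cong eval_tm_cong) auto
  then show ?case
    by (simp only: sat.simps)
next
  case (Neg \<phi>)
  have "sat M e \<phi> \<longleftrightarrow> sat M e' \<phi>"
    by (rule Neg.IH) (use Neg.prems in auto)
  then show ?case
    by simp
next
  case (Conj \<phi> \<psi>)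
  have "sat M e \<phi> \<longleftrightarrow> sat M e' \<phi>"
    by (rule Conj.IH(1)) (use Conj.prems in auto)
  moreover have "sat M e \<psi> \<longleftrightarrow> sat M e' \<psi>"
    by (rule Conj.IH(2)) (use Conj.prems in auto)
  ultimately show ?case
    by simp
next
  case (Exists i \<phi>)
  have "sat M (e(i := a)) \<phi> \<longleftrightarrow> sat M (e'(i := a)) \<phi>" for a
    by (rule Exists.IH) (use Exists.prems in auto)
  then show ?case
    by simp
qed

lemma eval_tm_closed:
  assumes "group_structure L M" "\<And>v. e v \<in> carrier M"
  shows "wf_tm L t \<Longrightarrow> eval_tm M e t \<in> carrier M"
proof (induction t)
  case (Fn f ts)
  then have "set (map (eval_tm M e) ts) \<subseteq> carrier M"
    by (auto simp: list_all_iff)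
  moreover have "fun_ar L f = Some (length (map (eval_tm M e) ts))"
    using Fn.prems by simp
  ultimately show ?case
    using assms(1) unfolding group_structure_def eval_tm.simps by blast
next
  case (Prod s t)
  then show ?case
    using assms by (simp add: group_structure_def group.is_monoid monoid.m_closed)
next
  case (Inverse t)
  then show ?case
    using assms by (simp add: group_structure_def group.inv_closed)
next
  case Unit
  show ?case
    using assms by (simp add: group_structure_def group.is_monoid monoid.one_closed)
qed (use assms in auto)

text \<open>
  Renaming acts on bound variables too; for injective renamings this avoids capture.
\<close>

primrec ren_tm :: "(nat \<Rightarrow> nat) \<Rightarrow> 'f tm \<Rightarrow> 'f tm" where
  "ren_tm f (Var i) = Var (f i)"
| "ren_tm f Unit = Unit"
| "ren_tm f (Prod s t) = Prod (ren_tm f s) (ren_tm f t)"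
| "ren_tm f (Inverse t) = Inverse (ren_tm f t)"
| "ren_tm f (Fn g ts) = Fn g (map (ren_tm f) ts)"

text \<open>Relation symbols stay as they are: the variables of the formula inside
  \<open>QPred\<close> belong to the symbol and are not variables of the atom.\<close>

primrec ren :: "(nat \<Rightarrow> nat) \<Rightarrow> ('f, 'r) fm \<Rightarrow> ('f, 'r) fm" where
  "ren f (Equal s t) = Equal (ren_tm f s) (ren_tm f t)"
| "ren f (Atom R ts) = Atom R (map (ren_tm f) ts)"
| "ren f (Neg \<phi>) = Neg (ren f \<phi>)"
| "ren f (Conj \<phi> \<psi>) = Conj (ren f \<phi>) (ren f \<psi>)"
| "ren f (Exists i \<phi>) = Exists (f i) (ren f \<phi>)"

lemma eval_ren_tm: "eval_tm M e (ren_tm f t) = eval_tm M (e \<circ> f) t"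
proof (induction t)
  case (Fn g ts)
  then have "map (eval_tm M e) (map (ren_tm f) ts) = map (eval_tm M (e \<circ> f)) ts"
    by (simp add: comp_def)
  then show ?case
    by (simp only: ren_tm.simps eval_tm.simps)
qed auto

lemma fv_ren_tm: "fv_tm (ren_tm f t) = f ` fv_tm t"
  by (induction t) auto

lemma wf_ren_tm: "wf_tm L (ren_tm f t) \<longleftrightarrow> wf_tm L t"
  by (induction t) (auto simp: list_all_iff)

lemma sat_ren:
  assumes "inj f"
  shows "sat M e (ren f \<phi>) \<longleftrightarrow> sat M (e \<circ> f) \<phi>"
proof (induction \<phi> arbitrary: e rule: fm_induct)
  case (Atom R ts)
  have "map (eval_tm M e) (map (ren_tm f) ts) = map (eval_tm M (e \<circ> f)) ts"
    by (simp add: eval_ren_tm)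
  then show ?case
    by (simp only: ren.simps sat.simps)
next
  case (Exists i \<phi>)
  have upd: "e(f i := a) \<circ> f = (e \<circ> f)(i := a)" for a
    using assms by (auto simp: fun_eq_iff inj_eq)
  show ?case
    by (simp only: ren.simps sat.simps Exists.IH upd)
qed (auto simp: eval_ren_tm)

lemma fv_ren:
  assumes "inj f"
  shows "fv (ren f \<phi>) = f ` fv \<phi>"
  using assms by (induction \<phi> rule: fm_induct) (auto simp: fv_ren_tm image_set_diff)

lemma wf_ren: "wf_fm L (ren f \<phi>) \<longleftrightarrow> wf_fm L \<phi>"
  by (induction \<phi> rule: fm_induct) (auto simp: wf_ren_tm)

section \<open>Implications, finite conjunctions and blocks of quantifiers\<close>

abbreviation Imp :: "('f, 'r) fm \<Rightarrow> ('f, 'r) fm \<Rightarrow> ('f, 'r) fm" where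
  "Imp \<phi> \<psi> \<equiv> Neg (Conj \<phi> (Neg \<psi>))"

definition Conjs :: "('f, 'r) fm list \<Rightarrow> ('f, 'r) fm" where
  "Conjs \<phi>s = foldr Conj \<phi>s (Equal Unit Unit)"

lemma sat_Conjs: "sat M e (Conjs \<phi>s) \<longleftrightarrow> (\<forall>\<phi>\<in>set \<phi>s. sat M e \<phi>)"
  unfolding Conjs_def by (induction \<phi>s) auto

lemma wf_Conjs: "wf_fm L (Conjs \<phi>s) \<longleftrightarrow> (\<forall>\<phi>\<in>set \<phi>s. wf_fm L \<phi>)"
  unfolding Conjs_def by (induction \<phi>s) auto

lemma fv_Conjs: "fv (Conjs \<phi>s) = \<Union> (fv ` set \<phi>s)"
  unfolding Conjs_def by (induction \<phi>s) auto

definition Forall :: "nat list \<Rightarrow> ('f, 'r) fm \<Rightarrow> ('f, 'r) fm" where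
  "Forall vs \<phi> = Neg (foldr Exists vs (Neg \<phi>))"

lemma sat_foldr_Exists:
  "sat M e (foldr Exists vs \<phi>) \<longleftrightarrow>
     (\<exists>e'. (\<forall>v\<in>set vs. e' v \<in> carrier M) \<and> (\<forall>v. v \<notin> set vs \<longrightarrow> e' v = e v) \<and> sat M e' \<phi>)"
proof (induction vs arbitrary: e)
  case Nil
  have "(\<forall>v. e' v = e v) \<longleftrightarrow> e' = e" for e'
    by auto
  then show ?case
    by simp
next
  case (Cons w vs)
  show ?case
  proof
    assume "sat M e (foldr Exists (w # vs) \<phi>)"
    then obtain a e' where a: "a \<in> carrier M" and e': "\<forall>v\<in>set vs. e' v \<in> carrier M"
        "\<forall>v. v \<notin> set vs \<longrightarrow> e' v = (e(w := a)) v" "sat M e' \<phi>"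
      by (auto simp: Cons.IH)
    \<comment> \<open>If \<open>w\<close> is quantified again in \<open>vs\<close>, the inner
      quantifier supplies its value; otherwise the value is \<open>a\<close>.\<close>
    have "e' w \<in> carrier M"
      using a e' by (cases "w \<in> set vs") auto
    with e' show "\<exists>e'. (\<forall>v\<in>set (w # vs). e' v \<in> carrier M) \<and>
        (\<forall>v. v \<notin> set (w # vs) \<longrightarrow> e' v = e v) \<and> sat M e' \<phi>"
      by (intro exI[of _ e']) auto
  next
    assume "\<exists>e'. (\<forall>v\<in>set (w # vs). e' v \<in> carrier M) \<and>
        (\<forall>v. v \<notin> set (w # vs) \<longrightarrow> e' v = e v) \<and> sat M e' \<phi>"
    then obtain e' where e': "\<forall>v\<in>set (w # vs). e' v \<in> carrier M"
        "\<forall>v. v \<notin> set (w # vs) \<longrightarrow> e' v = e v" "sat M e' \<phi>"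
      by blast
    have "sat M (e(w := e' w)) (foldr Exists vs \<phi>)"
      unfolding Cons.IH using e' by (intro exI[of _ e']) auto
    then show "sat M e (foldr Exists (w # vs) \<phi>)"
      using e' by auto
  qed
qed

lemma sat_Forall:
  "sat M e (Forall vs \<phi>) \<longleftrightarrow>
     (\<forall>e'. (\<forall>v\<in>set vs. e' v \<in> carrier M) \<longrightarrow> (\<forall>v. v \<notin> set vs \<longrightarrow> e' v = e v) \<longrightarrow> sat M e' \<phi>)"
  by (auto simp: Forall_def sat_foldr_Exists)

lemma wf_Forall: "wf_fm L (Forall vs \<phi>) \<longleftrightarrow> wf_fm L \<phi>"
proof -
  have "wf_fm L (foldr Exists vs \<psi>) \<longleftrightarrow> wf_fm L \<psi>" for \<psi>
    by (induction vs) auto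
  then show ?thesis
    by (simp add: Forall_def)
qed

lemma fv_Forall: "fv (Forall vs \<phi>) = fv \<phi> - set vs"
proof -
  have "fv (foldr Exists vs \<psi>) = fv \<psi> - set vs" for \<psi> :: "('a, 'b) fm"
    by (induction vs) auto
  then show ?thesis
    by (simp add: Forall_def)
qed

section \<open>Los's theorem\<close>

locale ultraproduct_of_groups =
  fixes L :: "('f, 'r) signature" and U :: "'i filter" and Gs :: "'i \<Rightarrow> ('a, 'f, 'r) lstruct"
  assumes ultra: "eventually P U \<or> eventually (\<lambda>i. \<not> P i) U"
    and proper: "U \<noteq> bot"
    and structures: "group_structure L (Gs i)"
begin

abbreviation "\<Pi>U \<equiv> ultraproduct U Gs"

definition sections :: "('i \<Rightarrow> 'a) set" where
  "sections = {a. \<forall>i. a i \<in> carrier (Gs i)}"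

definition cls :: "('i \<Rightarrow> 'a) \<Rightarrow> ('i \<Rightarrow> 'a) set" where
  "cls a = ultra_rel U Gs `` {a}"

definition rep :: "('i \<Rightarrow> 'a) set \<Rightarrow> 'i \<Rightarrow> 'a" where
  "rep X = (SOME a. a \<in> X)"

lemma group_factor: "group (Gs i)"
  using structures by (simp add: group_structure_def)

lemma mem_cls_iff: "b \<in> cls a \<longleftrightarrow> a \<in> sections \<and> b \<in> sections \<and> eventually (\<lambda>i. a i = b i) U"
  by (auto simp: cls_def ultra_rel_def sections_def)

lemma cls_eq_iff:
  assumes "a \<in> sections" "b \<in> sections"
  shows "cls a = cls b \<longleftrightarrow> eventually (\<lambda>i. a i = b i) U"
proof
  assume "cls a = cls b"
  moreover have "b \<in> cls b"
    using assms(2) by (simp add: mem_cls_iff)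
  ultimately have "b \<in> cls a"
    by simp
  then show "eventually (\<lambda>i. a i = b i) U"
    by (simp add: mem_cls_iff)
next
  assume ab: "eventually (\<lambda>i. a i = b i) U"
  have "eventually (\<lambda>i. a i = c i) U \<longleftrightarrow> eventually (\<lambda>i. b i = c i) U" for c
  proof
    assume "eventually (\<lambda>i. a i = c i) U"
    with ab show "eventually (\<lambda>i. b i = c i) U"
      by eventually_elim simp
  next
    assume "eventually (\<lambda>i. b i = c i) U"
    with ab show "eventually (\<lambda>i. a i = c i) U"
      by eventually_elim simp
  qed
  then show "cls a = cls b"
    using assms unfolding set_eq_iff mem_cls_iff by blast
qed

text \<open>The operations of the ultraproduct are computed on representatives picked by choice.
  This is what allows any other section of the class to be substituted.\<close>

lemma rep_cls:
  assumes "a \<in> sections"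
  shows "rep (cls a) \<in> sections" "eventually (\<lambda>i. rep (cls a) i = a i) U"
proof -
  have "a \<in> cls a"
    using assms by (simp add: mem_cls_iff)
  then have rep: "rep (cls a) \<in> cls a"
    unfolding rep_def by (rule someI[of "\<lambda>x. x \<in> cls a"])
  then show "rep (cls a) \<in> sections"
    unfolding mem_cls_iff by blast
  have "eventually (\<lambda>i. a i = rep (cls a) i) U"
    using rep unfolding mem_cls_iff by blast
  then show "eventually (\<lambda>i. rep (cls a) i = a i) U"
    by eventually_elim simp
qed

lemma eventually_rep_cls_list:
  assumes "\<And>a. a \<in> set as \<Longrightarrow> a \<in> sections"
  shows "eventually (\<lambda>i. map (\<lambda>X. rep X i) (map cls as) = map (\<lambda>a. a i) as) U"
proof -
  have "eventually (\<lambda>i. \<forall>a\<in>set as. rep (cls a) i = a i) U"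
    using assms rep_cls(2) by (intro eventually_ball_finite) auto
  then show ?thesis
    by eventually_elim simp
qed

lemma carrier_ultraproduct: "carrier \<Pi>U = cls ` sections"
  by (auto simp: ultraproduct_def Let_def quotient_def cls_def sections_def)

lemma one_ultraproduct: "\<one>\<^bsub>\<Pi>U\<^esub> = cls (\<lambda>i. \<one>\<^bsub>Gs i\<^esub>)"
  by (simp add: ultraproduct_def Let_def cls_def)

lemma sections_mult:
  "a \<in> sections \<Longrightarrow> b \<in> sections \<Longrightarrow> (\<lambda>i. a i \<otimes>\<^bsub>Gs i\<^esub> b i) \<in> sections"
  by (simp add: sections_def group.is_monoid[OF group_factor] monoid.m_closed)

lemma sections_one: "(\<lambda>i. \<one>\<^bsub>Gs i\<^esub>) \<in> sections"
  by (simp add: sections_def group.is_monoid[OF group_factor] monoid.one_closed)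

lemma sections_inv: "a \<in> sections \<Longrightarrow> (\<lambda>i. inv\<^bsub>Gs i\<^esub> a i) \<in> sections"
  by (simp add: sections_def group.inv_closed[OF group_factor])

lemma mult_ultraproduct:
  assumes "a \<in> sections" "b \<in> sections"
  shows "cls a \<otimes>\<^bsub>\<Pi>U\<^esub> cls b = cls (\<lambda>i. a i \<otimes>\<^bsub>Gs i\<^esub> b i)"
proof -
  have "cls a \<otimes>\<^bsub>\<Pi>U\<^esub> cls b = cls (\<lambda>i. rep (cls a) i \<otimes>\<^bsub>Gs i\<^esub> rep (cls b) i)"
    by (simp add: ultraproduct_def Let_def cls_def rep_def)
  also have "\<dots> = cls (\<lambda>i. a i \<otimes>\<^bsub>Gs i\<^esub> b i)"
  proof (rule cls_eq_iff[THEN iffD2])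
    show "eventually (\<lambda>i. rep (cls a) i \<otimes>\<^bsub>Gs i\<^esub> rep (cls b) i = a i \<otimes>\<^bsub>Gs i\<^esub> b i) U"
      using rep_cls(2)[OF assms(1)] rep_cls(2)[OF assms(2)] by eventually_elim simp
  qed (intro sections_mult rep_cls assms)+
  finally show ?thesis .
qed

text \<open>The inverse is a definite description, so existence and uniqueness are both checked in
  the quotient; uniqueness reduces to uniqueness of inverses in almost every factor.\<close>

lemma inv_ultraproduct:
  assumes a: "a \<in> sections"
  shows "inv\<^bsub>\<Pi>U\<^esub> (cls a) = cls (\<lambda>i. inv\<^bsub>Gs i\<^esub> a i)"
  unfolding m_inv_def[of \<Pi>U]
proof (rule the_equality)
  let ?b = "\<lambda>i. inv\<^bsub>Gs i\<^esub> a i"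
  have "cls a \<otimes>\<^bsub>\<Pi>U\<^esub> cls ?b = \<one>\<^bsub>\<Pi>U\<^esub>" "cls ?b \<otimes>\<^bsub>\<Pi>U\<^esub> cls a = \<one>\<^bsub>\<Pi>U\<^esub>"
    using a unfolding mult_ultraproduct[OF a sections_inv[OF a]]
      mult_ultraproduct[OF sections_inv[OF a] a] one_ultraproduct
    by (simp_all add: group.r_inv[OF group_factor] group.l_inv[OF group_factor] sections_def)
  then show "cls ?b \<in> carrier \<Pi>U \<and> cls a \<otimes>\<^bsub>\<Pi>U\<^esub> cls ?b = \<one>\<^bsub>\<Pi>U\<^esub> \<and> cls ?b \<otimes>\<^bsub>\<Pi>U\<^esub> cls a = \<one>\<^bsub>\<Pi>U\<^esub>"
    using sections_inv[OF a] by (simp add: carrier_ultraproduct)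
next
  fix Y assume Y: "Y \<in> carrier \<Pi>U \<and> cls a \<otimes>\<^bsub>\<Pi>U\<^esub> Y = \<one>\<^bsub>\<Pi>U\<^esub> \<and> Y \<otimes>\<^bsub>\<Pi>U\<^esub> cls a = \<one>\<^bsub>\<Pi>U\<^esub>"
  then obtain b where b: "b \<in> sections" "Y = cls b"
    by (auto simp: carrier_ultraproduct)
  have "eventually (\<lambda>i. b i \<otimes>\<^bsub>Gs i\<^esub> a i = \<one>\<^bsub>Gs i\<^esub>) U"
    using Y unfolding b(2) mult_ultraproduct[OF b(1) a] one_ultraproduct
    by (simp add: cls_eq_iff sections_mult sections_one a b)
  then have "eventually (\<lambda>i. b i = inv\<^bsub>Gs i\<^esub> a i) U"
  proof eventually_elim
    case (elim i)
    then show ?case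
      using a b group.inv_equality[OF group_factor, of i "b i" "a i"] by (simp add: sections_def)
  qed
  then show "Y = cls (\<lambda>i. inv\<^bsub>Gs i\<^esub> a i)"
    by (simp add: b cls_eq_iff sections_inv a)
qed

lemma sections_eval_tm:
  assumes "wf_tm L t" "\<And>v. e v \<in> sections"
  shows "(\<lambda>i. eval_tm (Gs i) (\<lambda>v. e v i) t) \<in> sections"
  using assms eval_tm_closed[OF structures] by (simp add: sections_def)

lemma eval_ultraproduct:
  assumes e: "\<And>v. e v \<in> sections"
  shows "wf_tm L t \<Longrightarrow> eval_tm \<Pi>U (\<lambda>v. cls (e v)) t = cls (\<lambda>i. eval_tm (Gs i) (\<lambda>v. e v i) t)"
proof (induction t)
  case (Prod s t)
  then show ?case
    by (simp add: mult_ultraproduct sections_eval_tm e)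
next
  case (Inverse t)
  then show ?case
    by (simp add: inv_ultraproduct sections_eval_tm e)
next
  case (Fn f ts)
  define as where "as = map (\<lambda>t i. eval_tm (Gs i) (\<lambda>v. e v i) t) ts"
  have wf: "wf_tm L t" if "t \<in> set ts" for t
    using Fn.prems that by (auto simp: list_all_iff)
  have as: "a \<in> sections" if "a \<in> set as" for a
    using that wf by (auto simp: as_def sections_eval_tm e)
  have rep_as: "eventually (\<lambda>i. map (\<lambda>X. rep X i) (map cls as) = map (\<lambda>a. a i) as) U"
    by (rule eventually_rep_cls_list) (rule as)
  have length: "fun_ar L f = Some (length as)"
    using Fn.prems by (simp add: as_def)
  \<comment> \<open>Two classes can be compared by \<open>cls_eq_iff\<close> only when both
    functions are sections. The map \<open>h\<close> covers the given sections and their chosen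
    representatives at once.\<close>
  have closed: "(\<lambda>i. fun_int (Gs i) f (map (\<lambda>a. h a i) as)) \<in> sections"
    if "\<And>a. a \<in> set as \<Longrightarrow> h a \<in> sections" for h
  proof -
    have "set (map (\<lambda>a. h a i) as) \<subseteq> carrier (Gs i)" for i
      using that by (auto simp: sections_def)
    then show ?thesis
      using structures length unfolding group_structure_def sections_def mem_Collect_eq
      by (metis length_map)
  qed
  have "map (eval_tm \<Pi>U (\<lambda>v. cls (e v))) ts = map cls as"
    using Fn.IH wf by (simp add: as_def)
  then have "eval_tm \<Pi>U (\<lambda>v. cls (e v)) (Fn f ts)
      = cls (\<lambda>i. fun_int (Gs i) f (map (\<lambda>X. rep X i) (map cls as)))"
    by (simp add: ultraproduct_def Let_def cls_def rep_def)
  also have "\<dots> = cls (\<lambda>i. fun_int (Gs i) f (map (\<lambda>a. a i) as))"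
  proof (rule cls_eq_iff[THEN iffD2])
    show "(\<lambda>i. fun_int (Gs i) f (map (\<lambda>X. rep X i) (map cls as))) \<in> sections"
      using closed[of "\<lambda>a. rep (cls a)"] rep_cls(1) as by (simp add: comp_def)
    show "(\<lambda>i. fun_int (Gs i) f (map (\<lambda>a. a i) as)) \<in> sections"
      using closed[of "\<lambda>a. a"] as by simp
    show "eventually (\<lambda>i. fun_int (Gs i) f (map (\<lambda>X. rep X i) (map cls as))
        = fun_int (Gs i) f (map (\<lambda>a. a i) as)) U"
      using rep_as by eventually_elim (rule arg_cong)
  qed
  finally show ?case
    by (simp add: as_def comp_def)
qed (auto simp: one_ultraproduct)

text \<open>Counting predicates are handled as ordinary atoms, because the ultraproduct interprets
  every relation symbol coordinatewise. The ultrafilter dichotomy enters at negation, the choice of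
  witnesses at the existential quantifier.\<close>

theorem los:
  assumes "wf_fm L \<phi>" "\<And>v. e v \<in> sections"
  shows "sat \<Pi>U (\<lambda>v. cls (e v)) \<phi> \<longleftrightarrow> eventually (\<lambda>i. sat (Gs i) (\<lambda>v. e v i) \<phi>) U"
  using assms
proof (induction \<phi> arbitrary: e rule: fm_induct)
  case (Equal s t)
  then show ?case
    by (simp add: eval_ultraproduct cls_eq_iff sections_eval_tm)
next
  case (Atom R ts)
  define as where "as = map (\<lambda>t i. eval_tm (Gs i) (\<lambda>v. e v i) t) ts"
  have wf: "wf_tm L t" if "t \<in> set ts" for t
    using Atom.prems that by auto
  have as: "a \<in> sections" if "a \<in> set as" for a
    using that wf by (auto simp: as_def sections_eval_tm Atom.prems)
  have rep_as: "eventually (\<lambda>i. map (\<lambda>X. rep X i) (map cls as) = map (\<lambda>a. a i) as) U"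
    by (rule eventually_rep_cls_list) (rule as)
  have "map (eval_tm \<Pi>U (\<lambda>v. cls (e v))) ts = map cls as"
    using eval_ultraproduct[OF Atom.prems(2)] wf by (simp add: as_def)
  then have "sat \<Pi>U (\<lambda>v. cls (e v)) (Atom R ts)
      \<longleftrightarrow> eventually (\<lambda>i. rel_int (Gs i) R (map (\<lambda>X. rep X i) (map cls as))) U"
    by (simp add: ultraproduct_def Let_def rep_def)
  also have "\<dots> \<longleftrightarrow> eventually (\<lambda>i. rel_int (Gs i) R (map (\<lambda>a. a i) as)) U"
  proof (rule eventually_subst)
    show "eventually (\<lambda>i. rel_int (Gs i) R (map (\<lambda>X. rep X i) (map cls as))
        = rel_int (Gs i) R (map (\<lambda>a. a i) as)) U"
      using rep_as by eventually_elim (rule arg_cong)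
  qed
  finally show ?case
    by (simp add: as_def comp_def)
next
  case (Neg \<phi>)
  have "eventually (\<lambda>i. \<not> P i) U \<longleftrightarrow> \<not> eventually P U" for P
  proof
    assume "eventually (\<lambda>i. \<not> P i) U"
    show "\<not> eventually P U"
    proof
      assume "eventually P U"
      with \<open>eventually (\<lambda>i. \<not> P i) U\<close> have "eventually (\<lambda>i. False) U"
        by eventually_elim simp
      then show False
        using proper by (simp add: trivial_limit_def)
    qed
  qed (use ultra in blast)
  then show ?case
    using Neg by simp
next
  case (Conj \<phi> \<psi>)
  then show ?case
    by (simp add: eventually_conj_iff)
next
  case (Exists j \<phi>)
  have upd: "sat \<Pi>U ((\<lambda>v. cls (e v))(j := cls a)) \<phi>
      \<longleftrightarrow> eventually (\<lambda>i. sat (Gs i) ((\<lambda>v. e v i)(j := a i)) \<phi>) U" if a: "a \<in> sections" for a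
  proof -
    have "(\<lambda>v. cls (e v))(j := cls a) = (\<lambda>v. cls ((e(j := a)) v))"
      "(\<lambda>v. e v i)(j := a i) = (\<lambda>v. (e(j := a)) v i)" for i
      by (simp_all add: fun_eq_iff)
    then show ?thesis
      using Exists.IH[of "e(j := a)"] Exists.prems a by simp
  qed
  show ?case
  proof
    assume "sat \<Pi>U (\<lambda>v. cls (e v)) (Exists j \<phi>)"
    then obtain a where a: "a \<in> sections" "sat \<Pi>U ((\<lambda>v. cls (e v))(j := cls a)) \<phi>"
      by (auto simp: carrier_ultraproduct)
    then have "eventually (\<lambda>i. sat (Gs i) ((\<lambda>v. e v i)(j := a i)) \<phi>) U"
      using upd by blast
    then show "eventually (\<lambda>i. sat (Gs i) (\<lambda>v. e v i) (Exists j \<phi>)) U"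
      by eventually_elim (use a(1) in \<open>auto simp: sections_def\<close>)
  next
    assume *: "eventually (\<lambda>i. sat (Gs i) (\<lambda>v. e v i) (Exists j \<phi>)) U"
    \<comment> \<open>A section needs a value at every index, so indices where the existential fails
      receive an arbitrary carrier element.\<close>
    have "\<exists>a. a \<in> carrier (Gs i) \<and> (sat (Gs i) (\<lambda>v. e v i) (Exists j \<phi>) \<longrightarrow>
        sat (Gs i) ((\<lambda>v. e v i)(j := a)) \<phi>)" for i
      using sections_one by (cases "sat (Gs i) (\<lambda>v. e v i) (Exists j \<phi>)") (auto simp: sections_def)
    then obtain a where a: "\<And>i. a i \<in> carrier (Gs i)" "\<And>i. sat (Gs i) (\<lambda>v. e v i) (Exists j \<phi>) \<Longrightarrow>
        sat (Gs i) ((\<lambda>v. e v i)(j := a i)) \<phi>"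
      by metis
    have "a \<in> sections"
      using a(1) by (simp add: sections_def)
    moreover have "eventually (\<lambda>i. sat (Gs i) ((\<lambda>v. e v i)(j := a i)) \<phi>) U"
      using * by (rule eventually_mono) (rule a(2))
    ultimately show "sat \<Pi>U (\<lambda>v. cls (e v)) (Exists j \<phi>)"
      using upd by (auto simp: carrier_ultraproduct)
  qed
qed

text \<open>Elements of \<open>G\<close> outside the image of \<open>j\<close> are reached by
  closing the formula universally. The closure is a sentence, so the constant assignment
  \<open>c\<close> is as good as any, and it passes from the factors to the ultraproduct and on to
  \<open>G\<close>.\<close>

lemma transfer_to_extension:
  assumes j: "elementary_embedding L \<Pi>U G j"
    and wf: "wf_fm L \<phi>"
    and ev: "eventually (\<lambda>i. \<forall>e. range e \<subseteq> carrier (Gs i) \<longrightarrow> sat (Gs i) e \<phi>) U"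
    and e: "range e \<subseteq> carrier G"
  shows "sat G e \<phi>"
proof -
  define vs where "vs = sorted_list_of_set (fv \<phi>)"
  have vs: "set vs = fv \<phi>"
    by (simp add: vs_def finite_fv)
  define c where "c = (\<lambda>v::nat. cls (\<lambda>i. \<one>\<^bsub>Gs i\<^esub>))"
  have wf': "wf_fm L (Forall vs \<phi>)"
    using wf by (simp add: wf_Forall)
  have "sat (Gs i) (\<lambda>v. \<one>\<^bsub>Gs i\<^esub>) (Forall vs \<phi>)"
    if "\<forall>e. range e \<subseteq> carrier (Gs i) \<longrightarrow> sat (Gs i) e \<phi>" for i
    unfolding sat_Forall
  proof (intro allI impI)
    fix e' assume "\<forall>v\<in>set vs. e' v \<in> carrier (Gs i)" "\<forall>v. v \<notin> set vs \<longrightarrow> e' v = \<one>\<^bsub>Gs i\<^esub>"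
    then have "e' v \<in> carrier (Gs i)" for v
      using sections_one by (cases "v \<in> set vs") (auto simp: sections_def)
    then have "range e' \<subseteq> carrier (Gs i)"
      by (rule image_subsetI)
    then show "sat (Gs i) e' \<phi>"
      using that by simp
  qed
  then have "eventually (\<lambda>i. sat (Gs i) (\<lambda>v. \<one>\<^bsub>Gs i\<^esub>) (Forall vs \<phi>)) U"
    using ev by (rule eventually_mono[rotated])
  then have "sat \<Pi>U c (Forall vs \<phi>)"
    using los[OF wf', of "\<lambda>_ i. \<one>\<^bsub>Gs i\<^esub>"] sections_one by (simp add: c_def)
  moreover have "range c \<subseteq> carrier \<Pi>U"
    using sections_one by (auto simp: c_def carrier_ultraproduct)
  ultimately have "sat G (j \<circ> c) (Forall vs \<phi>)"
    using j wf' by (simp add: elementary_embedding_def)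
  moreover have "sat G e (Forall vs \<phi>) \<longleftrightarrow> sat G (j \<circ> c) (Forall vs \<phi>)"
    by (rule sat_cong) (simp add: fv_Forall vs)
  ultimately have "sat G e (Forall vs \<phi>)"
    by simp
  then show ?thesis
    unfolding sat_Forall using e by (elim allE[of _ e]) auto
qed

end

section \<open>Formulas for inclusions and products\<close>

lemma solutionsD: "as \<in> solutions M n \<phi> bs \<Longrightarrow> length as = n \<and> set as \<subseteq> carrier M"
  by (simp add: solutions_def)

lemma ex_assignment:
  assumes "set as \<subseteq> C" "set bs \<subseteq> C" "C \<noteq> {}"
  obtains e where "range e \<subseteq> C" "map e [0..<length as] = as"
    "map e [length as..<length as + length bs] = bs"
proof -
  obtain c where c: "c \<in> C"
    using assms(3) by blast
  let ?e = "\<lambda>v. if v < length as + length bs then (as @ bs) ! v else c"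
  have "?e v \<in> C" for v
  proof (cases "v < length as + length bs")
    case True
    then have "(as @ bs) ! v \<in> set (as @ bs)"
      by (intro nth_mem) simp
    then show ?thesis
      using assms True by auto
  qed (use c in simp)
  then have "range ?e \<subseteq> C"
    by (rule image_subsetI)
  moreover have "map ?e [0..<length as] = as"
    by (rule nth_equalityI) (auto simp: nth_append)
  moreover have "map ?e [length as..<length as + length bs] = bs"
    by (rule nth_equalityI) (auto simp: nth_append)
  ultimately show thesis
    by (rule that)
qed

text \<open>The bridge between total assignments, to which transfer applies, and the finite lists of
  points and parameters used by \<open>solutions\<close>. The bound on the free variables keeps list
  access within range.\<close>

lemma sat_iff_solutions:
  assumes "fv \<phi> \<subseteq> {..<n + m}" "range e \<subseteq> carrier M"
  shows "sat M e \<phi> \<longleftrightarrow> map e [0..<n] \<in> solutions M n \<phi> (map e [n..<n + m])"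
proof -
  have "map e [0..<n] @ map e [n..<n + m] = map e [0..<n + m]"
    using upt_add_eq_append[OF le0, of n m] by (simp only: map_append)
  then have "sat M e \<phi> \<longleftrightarrow> sat M (\<lambda>i. (map e [0..<n] @ map e [n..<n + m]) ! i) \<phi>"
    using assms(1) by (intro sat_cong) (auto simp: subset_iff)
  moreover have "set (map e [0..<n]) \<subseteq> carrier M"
    using assms(2) by auto
  ultimately show ?thesis
    by (simp add: solutions_def)
qed

lemma sat_ren_iff_solutions:
  assumes "inj f" "fv \<phi> \<subseteq> {..<n + m}" "range e \<subseteq> carrier M"
  shows "sat M e (ren f \<phi>) \<longleftrightarrow> map (e \<circ> f) [0..<n] \<in> solutions M n \<phi> (map (e \<circ> f) [n..<n + m])"
proof -
  have "range (e \<circ> f) \<subseteq> carrier M"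
    using assms(3) by auto
  then show ?thesis
    unfolding sat_ren[OF assms(1)] by (rule sat_iff_solutions[OF assms(2)])
qed

section \<open>Definitions over a common list of parameters\<close>

lemma solutions_append:
  assumes "fv \<phi> \<subseteq> {..<n + length bs}"
  shows "solutions M n \<phi> (bs @ cs) = solutions M n \<phi> bs"
proof -
  have "sat M (\<lambda>i. (as @ bs @ cs) ! i) \<phi> \<longleftrightarrow> sat M (\<lambda>i. (as @ bs) ! i) \<phi>" if "length as = n" for as
  proof (rule sat_cong)
    fix v assume "v \<in> fv \<phi>"
    then have "v < length (as @ bs)"
      using assms that by auto
    then show "(as @ bs @ cs) ! v = (as @ bs) ! v"
      by (auto simp: nth_append)
  qed
  then show ?thesis
    by (auto simp: solutions_def)
qed

lemma solutions_ren_prepend: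
  assumes "fv \<phi> \<subseteq> {..<n + length bs}"
  shows "solutions M n (ren (\<lambda>i. if i < n then i else i + length cs) \<phi>) (cs @ bs) = solutions M n \<phi> bs"
proof -
  let ?f = "\<lambda>i. if i < n then i else i + length cs"
  have f: "inj ?f"
    by (auto simp: inj_def split: if_splits)
  have "sat M ((\<lambda>i. (as @ cs @ bs) ! i) \<circ> ?f) \<phi> \<longleftrightarrow> sat M (\<lambda>i. (as @ bs) ! i) \<phi>"
    if "length as = n" for as
    using that by (intro sat_cong) (auto simp: nth_append)
  then show ?thesis
    unfolding solutions_def sat_ren[OF f] by auto
qed

lemma defined_by_append:
  assumes "defined_by L M n \<phi> bs X" "set cs \<subseteq> carrier M"
  shows "defined_by L M n \<phi> (bs @ cs) X"
  using assms solutions_append[of \<phi> n bs M cs] by (auto simp: defined_by_def)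

lemma defined_by_prepend:
  assumes "defined_by L M n \<phi> bs X" "set cs \<subseteq> carrier M"
  shows "defined_by L M n (ren (\<lambda>i. if i < n then i else i + length cs) \<phi>) (cs @ bs) X"
proof -
  have "inj (\<lambda>i. if i < n then i else i + length cs)"
    by (auto simp: inj_def split: if_splits)
  then show ?thesis
    using assms solutions_ren_prepend[of \<phi> n bs M cs]
    by (auto simp: defined_by_def wf_ren fv_ren)
qed

text \<open>One formula will speak about all the sets \<open>A F\<close> and has a single block of
  parameters. Adding new parameters at the end leaves the earlier formulas intact, so only the new
  formula has its parameters shifted.\<close>

lemma definable_common_parameters:
  assumes "finite I" "\<And>i. i \<in> I \<Longrightarrow> definable L M n (X i)"
  obtains bs \<phi> where "set bs \<subseteq> carrier M" "\<And>i. i \<in> I \<Longrightarrow> defined_by L M n (\<phi> i) bs (X i)"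
proof -
  have "\<exists>bs \<phi>. set bs \<subseteq> carrier M \<and> (\<forall>i\<in>I. defined_by L M n (\<phi> i) bs (X i))"
    using assms
  proof (induction I rule: finite_induct)
    case empty
    show ?case
      by (rule exI[of _ "[]"]) simp
  next
    case (insert i I)
    then obtain bs \<phi> where bs: "set bs \<subseteq> carrier M" "\<forall>i\<in>I. defined_by L M n (\<phi> i) bs (X i)"
      by blast
    obtain \<chi> cs where \<chi>: "defined_by L M n \<chi> cs (X i)"
      using insert.prems[of i] by (auto simp: definable_def)
    then have cs: "set cs \<subseteq> carrier M"
      by (simp add: defined_by_def)
    let ?\<phi> = "\<phi>(i := ren (\<lambda>i. if i < n then i else i + length bs) \<chi>)"
    have "defined_by L M n (?\<phi> k) (bs @ cs) (X k)" if "k \<in> insert i I" for k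
      using that bs(2) insert.hyps(2) defined_by_append[OF _ cs] defined_by_prepend[OF \<chi> bs(1)]
      by (cases "k = i") auto
    moreover have "set (bs @ cs) \<subseteq> carrier M"
      using bs cs by simp
    ultimately show ?case
      by blast
  qed
  then show thesis
    using that by blast
qed

text \<open>The parameters are read from position \<open>p\<close> on, so that predicates over
  different parameter blocks fit into one formula.\<close>

definition counts :: "rat \<Rightarrow> nat \<Rightarrow> nat \<Rightarrow> ('f, 'r) fm \<Rightarrow> nat \<Rightarrow> ('f, 'r) fm" where
  "counts r n m \<phi> p = Atom (QPred r n m \<phi>) (map Var [p..<p + m])"

lemma sat_counts: "sat M e (counts r n m \<phi> p) \<longleftrightarrow> rel_int M (QPred r n m \<phi>) (map e [p..<p + m])"
  by (simp add: counts_def comp_def)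

lemma wf_counts: "wf_fm L (counts r n m \<phi> p) \<longleftrightarrow> 0 \<le> r \<and> wf_fm L \<phi> \<and> fv \<phi> \<subseteq> {..<n + m}"
  by (auto simp: counts_def)

text \<open>
  The free variables of \<open>inclusion\<close> are the parameters \<open>0, \<dots>, m - 1\<close> of \<open>\<phi>\<close> followed by the
  parameters \<open>m, \<dots>, m + m' - 1\<close> of \<open>\<phi>'\<close>.
\<close>

definition inclusion :: "nat \<Rightarrow> nat \<Rightarrow> nat \<Rightarrow> ('f, 'r) fm \<Rightarrow> ('f, 'r) fm \<Rightarrow> ('f, 'r) fm" where
  "inclusion n m m' \<phi> \<phi>' = Forall [m + m'..<m + m' + n]
     (Imp (ren (\<lambda>i. if i < n then m + m' + i else if i < n + m' then i - n + m else i + m) \<phi>')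
          (ren (\<lambda>i. if i < n then m + m' + i else if i < n + m then i - n else i + m') \<phi>))"

lemma wf_inclusion: "wf_fm L (inclusion n m m' \<phi> \<phi>') \<longleftrightarrow> wf_fm L \<phi> \<and> wf_fm L \<phi>'"
  by (auto simp: inclusion_def wf_Forall wf_ren)

lemma sat_inclusion:
  assumes \<phi>: "fv \<phi> \<subseteq> {..<n + m}" and \<phi>': "fv \<phi>' \<subseteq> {..<n + m'}" and e: "range e \<subseteq> carrier M"
  shows "sat M e (inclusion n m m' \<phi> \<phi>') \<longleftrightarrow>
    solutions M n \<phi>' (map e [m..<m + m']) \<subseteq> solutions M n \<phi> (map e [0..<m])"
proof -
  \<comment> \<open>Variables in the third branch of either renaming can occur only bound. They move
    to \<open>n + m + m'\<close> and beyond, clear of the other two ranges, which keeps the renaming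
    injective.\<close>
  let ?f = "\<lambda>i. if i < n then m + m' + i else if i < n + m then i - n else i + m'"
  let ?f' = "\<lambda>i. if i < n then m + m' + i else if i < n + m' then i - n + m else i + m"
  let ?vs = "[m + m'..<m + m' + n]"
  have inj: "inj ?f" "inj ?f'"
    by (auto simp: inj_def split: if_splits)
  have body: "sat M e' (Imp (ren ?f' \<phi>') (ren ?f \<phi>)) \<longleftrightarrow>
      (map e' ?vs \<in> solutions M n \<phi>' (map e [m..<m + m']) \<longrightarrow>
       map e' ?vs \<in> solutions M n \<phi> (map e [0..<m]))"
    if e': "\<forall>v\<in>set ?vs. e' v \<in> carrier M" "\<forall>v. v \<notin> set ?vs \<longrightarrow> e' v = e v" for e'
  proof -
    have "e' v \<in> carrier M" for v
      using e' e by (cases "v \<in> set ?vs") auto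
    then have range: "range e' \<subseteq> carrier M"
      by (rule image_subsetI)
    have "map (e' \<circ> ?f) [0..<n] = map e' ?vs" "map (e' \<circ> ?f') [0..<n] = map e' ?vs"
      by (rule nth_equalityI; simp)+
    moreover have "map (e' \<circ> ?f) [n..<n + m] = map e [0..<m]"
      "map (e' \<circ> ?f') [n..<n + m'] = map e [m..<m + m']"
      using e'(2) by (auto intro!: nth_equalityI simp: add.commute)
    ultimately show ?thesis
      using sat_ren_iff_solutions[OF inj(1) \<phi> range] sat_ren_iff_solutions[OF inj(2) \<phi>' range]
      by (simp only: sat.simps) blast
  qed
  show ?thesis
  proof
    assume L: "sat M e (inclusion n m m' \<phi> \<phi>')"
    show "solutions M n \<phi>' (map e [m..<m + m']) \<subseteq> solutions M n \<phi> (map e [0..<m])"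
    proof
      fix as assume as: "as \<in> solutions M n \<phi>' (map e [m..<m + m'])"
      then have as': "length as = n" "set as \<subseteq> carrier M"
        by (auto dest: solutionsD)
      define e' where "e' v = (if v \<in> set ?vs then as ! (v - (m + m')) else e v)" for v
      have "map e' ?vs = as"
        using as' by (auto intro!: nth_equalityI simp: e'_def)
      moreover have e': "\<forall>v\<in>set ?vs. e' v \<in> carrier M" "\<forall>v. v \<notin> set ?vs \<longrightarrow> e' v = e v"
      proof -
        show "\<forall>v\<in>set ?vs. e' v \<in> carrier M"
          using \<open>map e' ?vs = as\<close> as'(2) by (metis imageI list.set_map subsetD)
      qed (simp add: e'_def)
      moreover have "sat M e' (Imp (ren ?f' \<phi>') (ren ?f \<phi>))"
        using L e' unfolding inclusion_def sat_Forall by blast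
      ultimately show "as \<in> solutions M n \<phi> (map e [0..<m])"
        using body[OF e'] as by simp
    qed
  next
    assume R: "solutions M n \<phi>' (map e [m..<m + m']) \<subseteq> solutions M n \<phi> (map e [0..<m])"
    show "sat M e (inclusion n m m' \<phi> \<phi>')"
      unfolding inclusion_def sat_Forall
    proof (intro allI impI)
      fix e' assume e': "\<forall>v\<in>set ?vs. e' v \<in> carrier M" "\<forall>v. v \<notin> set ?vs \<longrightarrow> e' v = e v"
      show "sat M e' (Imp (ren ?f' \<phi>') (ren ?f \<phi>))"
        using body[OF e'] R by blast
    qed
  qed
qed

section \<open>The formula defining the set of tuples\<close>

definition index_tm :: "nat set \<Rightarrow> 'f tm" where
  "index_tm F = foldr Prod (map (\<lambda>i. Var (i - 1)) (sorted_list_of_set F)) Unit"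

lemma eval_index_tm:
  assumes "F \<subseteq> {1..n}"
  shows "eval_tm M e (index_tm F) = index_prod M (map e [0..<n]) F"
proof -
  have "eval_tm M e (foldr Prod (map (\<lambda>i. Var (i - 1)) is) Unit)
      = foldr (mult M) (map (\<lambda>i. e (i - 1)) is) \<one>\<^bsub>M\<^esub>" for "is"
    by (induction "is") auto
  moreover have "map (\<lambda>i. e (i - 1)) (sorted_list_of_set F)
      = map (\<lambda>i. map e [0..<n] ! (i - 1)) (sorted_list_of_set F)"
  proof (rule map_cong[OF refl])
    fix i assume "i \<in> set (sorted_list_of_set F)"
    then have "i \<in> {1..n}"
      using assms finite_subset by fastforce
    then show "e (i - 1) = map e [0..<n] ! (i - 1)"
      by auto
  qed
  ultimately show ?thesis
    unfolding index_tm_def index_prod_def by (simp only:)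
qed

lemma fv_index_tm:
  assumes "F \<subseteq> {1..n}"
  shows "fv_tm (index_tm F :: 'f tm) \<subseteq> {..<n}"
proof -
  have "finite F"
    using assms finite_subset by blast
  moreover have "fv_tm (foldr Prod (map (\<lambda>i. Var (i - 1)) is) (Unit :: 'f tm)) = (\<lambda>i. i - 1) ` set is" for "is"
    by (induction "is") auto
  ultimately have "fv_tm (index_tm F :: 'f tm) = (\<lambda>i. i - 1) ` F"
    by (simp add: index_tm_def)
  moreover have "i - 1 < n" if "i \<in> F" for i
    using assms that by force
  ultimately show ?thesis
    by auto
qed

lemma wf_index_tm: "wf_tm L (index_tm F)"
proof -
  have "wf_tm L (foldr Prod (map (\<lambda>i. Var (i - 1)) is) Unit)" for "is"
    by (induction "is") auto
  then show ?thesis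
    by (simp add: index_tm_def)
qed

text \<open>
  \<open>member_fm n m \<phi> F\<close> says that \<open>x\<^sub>F\<close> satisfies \<open>\<phi>\<close>, where \<open>x\<close> consists of the variables
  \<open>0, \<dots>, n - 1\<close> and the parameters are moved to \<open>n, \<dots>, n + m - 1\<close>.
\<close>

definition member_fm :: "nat \<Rightarrow> nat \<Rightarrow> ('f, 'r) fm \<Rightarrow> nat set \<Rightarrow> ('f, 'r) fm" where
  "member_fm n m \<phi> F = Exists (n + m) (Conj (Equal (Var (n + m)) (index_tm F))
     (ren (\<lambda>i. if i = 0 then n + m else if i \<le> m then n + i - 1 else n + i) \<phi>))"

lemma inj_member_fm: "inj (\<lambda>i::nat. if i = 0 then n + m else if i \<le> m then n + i - 1 else n + i)"
  by (auto simp: inj_def split: if_splits)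

lemma wf_member_fm: "wf_fm L (member_fm n m \<phi> F) \<longleftrightarrow> wf_fm L \<phi>"
  by (simp add: member_fm_def wf_ren wf_index_tm)

lemma fv_member_fm:
  assumes "F \<subseteq> {1..n}" "fv \<phi> \<subseteq> {..<1 + m}"
  shows "fv (member_fm n m \<phi> F) \<subseteq> {..<n + m}"
  using assms(2) fv_index_tm[OF assms(1), where 'f = 'a]
  by (fastforce simp: member_fm_def fv_ren[OF inj_member_fm])

text \<open>The existential stands for substituting the term of \<open>F\<close> into
  \<open>\<phi>\<close>. Its variable \<open>n + m\<close> is the first one after the point and the
  parameters, so binding it disturbs neither, and its only possible value is the product.\<close>

lemma sat_member_fm:
  fixes M :: "('a, 'f, 'r) lstruct"
  assumes M: "group_structure L M" and F: "F \<subseteq> {1..n}" and \<phi>: "fv \<phi> \<subseteq> {..<1 + m}"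
    and e: "range e \<subseteq> carrier M"
  shows "sat M e (member_fm n m \<phi> F) \<longleftrightarrow>
    [index_prod M (map e [0..<n]) F] \<in> solutions M 1 \<phi> (map e [n..<n + m])"
proof -
  let ?f = "\<lambda>i. if i = 0 then n + m else if i \<le> m then n + i - 1 else n + i"
  let ?a = "index_prod M (map e [0..<n]) F"
  have tm: "eval_tm M (e(n + m := a)) (index_tm F) = ?a" for a
  proof -
    have "eval_tm M (e(n + m := a)) (index_tm F) = eval_tm M e (index_tm F)"
      using fv_index_tm[OF F, where 'f = 'f] by (intro eval_tm_cong) auto
    then show ?thesis
      by (simp add: eval_index_tm[OF F])
  qed
  have a: "?a \<in> carrier M"
    using eval_tm_closed[OF M _ wf_index_tm, of e F] e eval_index_tm[OF F, of M e] by auto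
  have "sat M e (member_fm n m \<phi> F) \<longleftrightarrow> sat M (e(n + m := ?a)) (ren ?f \<phi>)"
    using a by (auto simp: member_fm_def tm simp del: fun_upd_apply) (simp_all add: fun_upd_def)
  also have "\<dots> \<longleftrightarrow> map (e(n + m := ?a) \<circ> ?f) [0..<1]
      \<in> solutions M 1 \<phi> (map (e(n + m := ?a) \<circ> ?f) [1..<1 + m])"
    using inj_member_fm \<phi> by (rule sat_ren_iff_solutions) (use e a in auto)
  also have "map (e(n + m := ?a) \<circ> ?f) [1..<1 + m] = map e [n..<n + m]"
    by (rule nth_equalityI) (auto simp del: upt_Suc)
  also have "map (e(n + m := ?a) \<circ> ?f) [0..<1] = [?a]"
    by simp
  finally show ?thesis .
qed

text \<open>Index sets are not linearly ordered, so an arbitrary enumeration is picked for the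
  conjunction; satisfaction depends only on the set of conjuncts.\<close>

definition product_fm :: "nat \<Rightarrow> nat \<Rightarrow> (nat set \<Rightarrow> ('f, 'r) fm) \<Rightarrow> ('f, 'r) fm" where
  "product_fm n m \<phi> = Conjs (map (\<lambda>F. member_fm n m (\<phi> F) F)
     (SOME Fs. set Fs = index_sets n))"

lemma set_some_list: "finite A \<Longrightarrow> set (SOME xs. set xs = A) = A"
  by (rule someI_ex) (rule finite_list)

lemma wf_product_fm:
  "(\<And>F. F \<in> index_sets n \<Longrightarrow> wf_fm L (\<phi> F)) \<Longrightarrow> wf_fm L (product_fm n m \<phi>)"
  by (simp add: product_fm_def wf_Conjs wf_member_fm set_some_list[OF finite_index_sets])

lemma fv_product_fm:
  assumes "\<And>F. F \<in> index_sets n \<Longrightarrow> fv (\<phi> F) \<subseteq> {..<1 + m}"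
  shows "fv (product_fm n m \<phi>) \<subseteq> {..<n + m}"
proof -
  have "fv (member_fm n m (\<phi> F) F) \<subseteq> {..<n + m}" if "F \<in> index_sets n" for F
    by (rule fv_member_fm) (use assms[OF that] that in \<open>auto simp: index_sets_def\<close>)
  then show ?thesis
    unfolding product_fm_def fv_Conjs set_map set_some_list[OF finite_index_sets] by blast
qed

lemma solutions_product_fm:
  assumes M: "group_structure L M" and \<phi>: "\<And>F. F \<in> index_sets n \<Longrightarrow> fv (\<phi> F) \<subseteq> {..<1 + length bs}"
    and bs: "set bs \<subseteq> carrier M"
  shows "solutions M n (product_fm n (length bs) \<phi>) bs
    = product_tuples M n (\<lambda>F. {a. [a] \<in> solutions M 1 (\<phi> F) bs})"
proof -
  have "as \<in> solutions M n (product_fm n (length bs) \<phi>) bs \<longleftrightarrow>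
      (\<forall>F\<in>index_sets n. [index_prod M as F] \<in> solutions M 1 (\<phi> F) bs)"
    if as: "length as = n" "set as \<subseteq> carrier M" for as
  proof -
    have "carrier M \<noteq> {}"
      using M monoid.one_closed[OF group.is_monoid] by (auto simp: group_structure_def)
    then obtain e where e: "range e \<subseteq> carrier M" "map e [0..<n] = as"
        "map e [n..<n + length bs] = bs"
      using ex_assignment[OF as(2) bs] as(1) by auto
    have "as \<in> solutions M n (product_fm n (length bs) \<phi>) bs \<longleftrightarrow>
        sat M e (product_fm n (length bs) \<phi>)"
      using sat_iff_solutions[OF fv_product_fm[of n \<phi> "length bs", OF \<phi>] e(1)] e by simp
    also have "\<dots> \<longleftrightarrow> (\<forall>F\<in>index_sets n. sat M e (member_fm n (length bs) (\<phi> F) F))"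
      by (simp add: product_fm_def sat_Conjs set_some_list[OF finite_index_sets])
    also have "\<dots> \<longleftrightarrow> (\<forall>F\<in>index_sets n. [index_prod M as F] \<in> solutions M 1 (\<phi> F) bs)"
    proof (rule ball_cong[OF refl])
      fix F assume F: "F \<in> index_sets n"
      then have "F \<subseteq> {1..n}"
        by (simp add: index_sets_def)
      then show "sat M e (member_fm n (length bs) (\<phi> F) F)
          \<longleftrightarrow> [index_prod M as F] \<in> solutions M 1 (\<phi> F) bs"
        using sat_member_fm[OF M _ \<phi>[OF F] e(1), of F n] e by simp
    qed
    finally show ?thesis .
  qed
  then show ?thesis
    by (auto simp: product_tuples_def dest: solutionsD)
qed

section \<open>Transfer of the counting estimate\<close>

lemma card_solutions_1: "card (solutions M 1 \<phi> bs) = card {a. [a] \<in> solutions M 1 \<phi> bs}"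
proof -
  have "\<exists>a. as = [a]" if "as \<in> solutions M 1 \<phi> bs" for as
    using solutionsD[OF that] by (auto simp: length_Suc_conv)
  then have "solutions M 1 \<phi> bs = (\<lambda>a. [a]) ` {a. [a] \<in> solutions M 1 \<phi> bs}"
    by blast
  then show ?thesis
    by (metis (no_types, lifting) card_image inj_onI list.inject)
qed

section \<open>Rational approximation of products of real numbers\<close>

lemma rat_above: "\<exists>q. x < real_of_rat q \<and> real_of_rat q < y" if "x < y"
  using of_rat_dense[OF that] by blast

text \<open>Measures may be irrational while the predicates carry rational bounds. Choosing
  rationals within 1/(k+1) above each factor, the estimate survives the limit because finite
  products are continuous.\<close>

lemma le_prod_of_rat_above:
  fixes z :: "'i \<Rightarrow> real"
  assumes bound: "\<And>r. (\<And>i. i \<in> I \<Longrightarrow> z i < real_of_rat (r i)) \<Longrightarrow> x \<le> (\<Prod>i\<in>I. real_of_rat (r i))"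
  shows "x \<le> (\<Prod>i\<in>I. z i)"
proof -
  define r where "r k i = (SOME q. z i < real_of_rat q \<and> real_of_rat q < z i + inverse (real (Suc k)))"
    for k i
  have r: "z i < real_of_rat (r k i) \<and> real_of_rat (r k i) < z i + inverse (real (Suc k))" for k i
    unfolding r_def by (rule someI_ex) (simp add: rat_above)
  have "(\<lambda>k. z i + inverse (real (Suc k))) \<longlonglongrightarrow> z i" for i
    using tendsto_add[OF tendsto_const LIMSEQ_inverse_real_of_nat, of "z i"] by simp
  then have "(\<lambda>k. real_of_rat (r k i)) \<longlonglongrightarrow> z i" for i
    using r by (intro tendsto_sandwich[OF _ _ tendsto_const, of "z i" "\<lambda>k. real_of_rat (r k i)"])
      (auto intro!: always_eventually less_imp_le)
  then have "(\<lambda>k. \<Prod>i\<in>I. real_of_rat (r k i)) \<longlonglongrightarrow> (\<Prod>i\<in>I. z i)"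
    by (rule tendsto_prod)
  then show ?thesis
    by (rule LIMSEQ_le_const) (use bound r in blast)
qed

lemma ge_prod_of_rat_below:
  fixes z :: "'i \<Rightarrow> real"
  assumes pos: "\<And>i. i \<in> I \<Longrightarrow> 0 < z i"
    and bound: "\<And>r. (\<And>i. i \<in> I \<Longrightarrow> 0 \<le> r i \<and> real_of_rat (r i) < z i) \<Longrightarrow>
      (\<Prod>i\<in>I. real_of_rat (r i)) \<le> x"
  shows "(\<Prod>i\<in>I. z i) \<le> x"
proof -
  define r where "r k i = (SOME q. 0 \<le> q \<and> z i - inverse (real (Suc k)) < real_of_rat q \<and>
    real_of_rat q < z i)" for k i
  have r: "0 \<le> r k i \<and> z i - inverse (real (Suc k)) < real_of_rat (r k i) \<and> real_of_rat (r k i) < z i"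
    if i: "i \<in> I" for k i
    unfolding r_def
  proof (rule someI_ex)
    \<comment> \<open>The maximum with 0 keeps the bounds nonnegative, as the counting predicates
      require; positivity of \<open>z i\<close> leaves room for it.\<close>
    obtain q where "max 0 (z i - inverse (real (Suc k))) < real_of_rat q" "real_of_rat q < z i"
      using rat_above[of "max 0 (z i - inverse (real (Suc k)))" "z i"] pos[OF i] by auto
    then show "\<exists>q. 0 \<le> q \<and> z i - inverse (real (Suc k)) < real_of_rat q \<and> real_of_rat q < z i"
      by (intro exI[of _ q]) (auto simp: zero_less_of_rat_iff intro: less_imp_le)
  qed
  have "(\<lambda>k. z i - inverse (real (Suc k))) \<longlonglongrightarrow> z i" for i
    using tendsto_diff[OF tendsto_const LIMSEQ_inverse_real_of_nat, of "z i"] by simp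
  then have "(\<lambda>k. real_of_rat (r k i)) \<longlonglongrightarrow> z i" if "i \<in> I" for i
    using r that by (intro tendsto_sandwich[OF _ _ _ tendsto_const, of _ "\<lambda>k. real_of_rat (r k i)"])
      (auto intro!: always_eventually less_imp_le)
  then have "(\<lambda>k. \<Prod>i\<in>I. real_of_rat (r k i)) \<longlonglongrightarrow> (\<Prod>i\<in>I. z i)"
    by (rule tendsto_prod)
  then show ?thesis
    by (rule LIMSEQ_le_const2) (use bound r in blast)
qed

section \<open>Counting predicates and the measure in the ultra-quasirandom group\<close>

locale ultra_quasirandom_group =
  fixes L :: "('f, 'r) signature" and U :: "nat filter"
    and Gs :: "nat \<Rightarrow> ('a, 'f, 'r) lstruct" and G :: "('b, 'f, 'r) lstruct"
  assumes uqr: "ultra_quasirandom L U Gs G"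

sublocale ultra_quasirandom_group \<subseteq> ultraproduct_of_groups L U Gs
  using uqr by unfold_locales (auto simp: ultra_quasirandom_def nonprincipal_ultrafilter_def)

context ultra_quasirandom_group
begin

lemma structure_G: "group_structure L G"
  using uqr by (simp add: ultra_quasirandom_def)

lemma finite_factor: "finite (carrier (Gs k))"
  using uqr by (simp add: ultra_quasirandom_def)

lemma card_factor_pos: "0 < card (carrier (Gs k))"
  using finite_factor monoid.one_closed[OF group.is_monoid[OF group_factor]]
  by (auto simp: card_gt_0_iff)

lemma carrier_G: "carrier G \<noteq> {}"
  using structure_G monoid.one_closed[OF group.is_monoid] by (auto simp: group_structure_def)

lemma transfer:
  assumes "wf_fm L \<phi>" "eventually (\<lambda>k. \<forall>e. range e \<subseteq> carrier (Gs k) \<longrightarrow> sat (Gs k) e \<phi>) U"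
    and "range e \<subseteq> carrier G"
  shows "sat G e \<phi>"
proof -
  obtain j where "elementary_embedding L \<Pi>U G j"
    using uqr by (auto simp: ultra_quasirandom_def)
  then show ?thesis
    using assms by (rule transfer_to_extension)
qed

lemma sat_counts_factor:
  assumes "wf_fm L (counts r n m \<phi> p)" "range e \<subseteq> carrier (Gs k)"
  shows "sat (Gs k) e (counts r n m \<phi> p) \<longleftrightarrow>
    real (card (solutions (Gs k) n \<phi> (map e [p..<p + m])))
      \<le> real_of_rat r * real (card (carrier (Gs k))) ^ n"
proof -
  have "counting_structure L (Gs k)"
    using uqr by (simp add: ultra_quasirandom_def)
  moreover have "wf_rel L (QPred r n m \<phi>) m"
    using assms(1) by (simp add: wf_counts)
  moreover have "set (map e [p..<p + m]) \<subseteq> carrier (Gs k)"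
    using assms(2) by auto
  ultimately show ?thesis
    unfolding sat_counts counting_structure_def by (metis add_diff_cancel_left' length_map length_upt)
qed

lemma finite_solutions_factor: "finite (solutions (Gs k) n \<phi> bs)"
  by (rule finite_subset[OF _ finite_lists_length_eq[OF finite_factor, of k n]])
    (auto dest: solutionsD)

text \<open>The predicates of \<open>G\<close> are not given by cardinalities. Monotonicity in the
  set and in the bound holds by counting in every factor, and stating the inclusion by a formula
  makes it transferable.\<close>

lemma counts_G_mono:
  assumes \<phi>: "wf_fm L \<phi>" "fv \<phi> \<subseteq> {..<n + length bs}" "set bs \<subseteq> carrier G"
    and \<phi>': "wf_fm L \<phi>'" "fv \<phi>' \<subseteq> {..<n + length bs'}" "set bs' \<subseteq> carrier G"
    and sub: "solutions G n \<phi>' bs' \<subseteq> solutions G n \<phi> bs" and r: "0 \<le> r" "r \<le> r'"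
    and count: "rel_int G (QPred r n (length bs) \<phi>) bs"
  shows "rel_int G (QPred r' n (length bs') \<phi>') bs'"
proof -
  let ?m = "length bs" and ?m' = "length bs'"
  let ?\<theta> = "Imp (Conj (counts r n ?m \<phi> 0) (inclusion n ?m ?m' \<phi> \<phi>')) (counts r' n ?m' \<phi>' ?m)"
  have wf: "wf_fm L (counts r n ?m \<phi> 0)" "wf_fm L (counts r' n ?m' \<phi>' ?m)"
    using \<phi> \<phi>' r by (auto simp: wf_counts)
  have "sat (Gs k) e ?\<theta>" if e: "range e \<subseteq> carrier (Gs k)" for k and e :: "nat \<Rightarrow> 'a"
  proof -
    let ?S = "solutions (Gs k) n \<phi> (map e [0..<?m])"
    let ?S' = "solutions (Gs k) n \<phi>' (map e [?m..<?m + ?m'])"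
    let ?N = "real (card (carrier (Gs k)))"
    have "real (card ?S') \<le> real_of_rat r' * ?N ^ n"
      if "real (card ?S) \<le> real_of_rat r * ?N ^ n" "?S' \<subseteq> ?S"
    proof -
      have "card ?S' \<le> card ?S"
        using that(2) by (rule card_mono[OF finite_solutions_factor])
      then have "real (card ?S') \<le> real_of_rat r * ?N ^ n"
        using that(1) by linarith
      also have "\<dots> \<le> real_of_rat r' * ?N ^ n"
        using r(2) by (intro mult_right_mono) (auto simp: of_rat_less_eq)
      finally show ?thesis .
    qed
    then show ?thesis
      using sat_counts_factor[OF wf(1) e] sat_counts_factor[OF wf(2) e]
        sat_inclusion[OF \<phi>(2) \<phi>'(2) e] by simp
  qed
  moreover have "wf_fm L ?\<theta>"
    using wf \<phi>(1) \<phi>'(1) by (simp add: wf_inclusion)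
  moreover obtain e where e: "range e \<subseteq> carrier G" "map e [0..<?m] = bs"
      "map e [?m..<?m + ?m'] = bs'"
    using ex_assignment[OF \<phi>(3) \<phi>'(3) carrier_G] .
  ultimately have "sat G e ?\<theta>"
    by (intro transfer[OF _ _ e(1)] always_eventually) auto
  then show ?thesis
    using sat_inclusion[OF \<phi>(2) \<phi>'(2) e(1)] sub count e(2,3) by (simp add: sat_counts)
qed

text \<open>The bound 1 always holds, so the infimum in \<open>mu_fm\<close> is taken over a
  nonempty set.\<close>

lemma counts_G_one:
  assumes \<phi>: "wf_fm L \<phi>" "fv \<phi> \<subseteq> {..<n + length bs}" "set bs \<subseteq> carrier G"
  shows "rel_int G (QPred 1 n (length bs) \<phi>) bs"
proof -
  let ?\<theta> = "counts 1 n (length bs) \<phi> 0"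
  have wf: "wf_fm L ?\<theta>"
    using \<phi> by (simp add: wf_counts)
  have "sat (Gs k) e ?\<theta>" if e: "range e \<subseteq> carrier (Gs k)" for k and e :: "nat \<Rightarrow> 'a"
  proof -
    have "card (solutions (Gs k) n \<phi> bs') \<le> card (carrier (Gs k)) ^ n" for bs'
      unfolding card_lists_length_eq[OF finite_factor, symmetric]
      by (rule card_mono[OF finite_lists_length_eq[OF finite_factor]]) (auto dest: solutionsD)
    then show ?thesis
      using sat_counts_factor[OF wf e] by (simp flip: of_nat_power)
  qed
  moreover obtain e where e: "range e \<subseteq> carrier G" "map e [0..<length bs] = bs"
    using ex_assignment[OF \<phi>(3) _ carrier_G, of "[]"] by auto
  ultimately have "sat G e ?\<theta>"
    by (intro transfer[OF wf _ e(1)] always_eventually) auto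
  then show ?thesis
    by (simp add: sat_counts e)
qed

context
  fixes n :: nat and \<phi> :: "('f, 'r) fm" and bs :: "'b list"
  assumes \<phi>: "wf_fm L \<phi>" "fv \<phi> \<subseteq> {..<n + length bs}" "set bs \<subseteq> carrier G"
begin

lemma mu_fm_nonneg: "0 \<le> mu_fm G n \<phi> bs"
  unfolding mu_fm_def
proof (rule cInf_greatest)
  show "{real_of_rat r |r. 0 \<le> r \<and> rel_int G (QPred r n (length bs) \<phi>) bs} \<noteq> {}"
    using counts_G_one[OF \<phi>] zero_le_one by blast
qed auto

lemma mu_fm_le:
  assumes "0 \<le> r" "rel_int G (QPred r n (length bs) \<phi>) bs"
  shows "mu_fm G n \<phi> bs \<le> real_of_rat r"
  unfolding mu_fm_def
  by (rule cInf_lower) (use assms in \<open>auto intro: bdd_belowI[of _ 0]\<close>)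

text \<open>Some valid bound lies below \<open>r\<close>, and validity is upward closed. The
  inequality is strict because the infimum need not be attained.\<close>

lemma counts_if_mu_fm_less:
  assumes "mu_fm G n \<phi> bs < real_of_rat r"
  shows "rel_int G (QPred r n (length bs) \<phi>) bs"
proof -
  have "{real_of_rat r |r. 0 \<le> r \<and> rel_int G (QPred r n (length bs) \<phi>) bs} \<noteq> {}"
    using counts_G_one[OF \<phi>] zero_le_one by blast
  then obtain r0 where r0: "0 \<le> r0" "rel_int G (QPred r0 n (length bs) \<phi>) bs"
      "real_of_rat r0 < real_of_rat r"
    using cInf_lessD[OF _ assms[unfolded mu_fm_def]] by blast
  show ?thesis
    by (rule counts_G_mono[OF \<phi> \<phi> subset_refl r0(1) _ r0(2)]) (use r0(3) in \<open>simp add: of_rat_less\<close>)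
qed

end

text \<open>Equality of the defined sets gives inclusions both ways, hence the same valid bounds.
  This makes the definite description in \<open>mu\<close> meaningful.\<close>

lemma mu_fm_eq:
  assumes "defined_by L G n \<phi> bs X" "defined_by L G n \<phi>' bs' X"
  shows "mu_fm G n \<phi> bs = mu_fm G n \<phi>' bs'"
proof -
  have X: "solutions G n \<phi> bs = X" "solutions G n \<phi>' bs' = X"
    using assms by (simp_all add: defined_by_def)
  have \<phi>: "wf_fm L \<phi>" "fv \<phi> \<subseteq> {..<n + length bs}" "set bs \<subseteq> carrier G"
    and \<phi>': "wf_fm L \<phi>'" "fv \<phi>' \<subseteq> {..<n + length bs'}" "set bs' \<subseteq> carrier G"
    using assms by (simp_all add: defined_by_def)
  have "rel_int G (QPred r n (length bs) \<phi>) bs \<longleftrightarrow> rel_int G (QPred r n (length bs') \<phi>') bs'"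
    if "0 \<le> r" for r
    using counts_G_mono[OF \<phi> \<phi>' _ that order_refl] counts_G_mono[OF \<phi>' \<phi> _ that order_refl]
    unfolding X by blast
  then show ?thesis
    unfolding mu_fm_def by (intro arg_cong[where f = Inf] Collect_cong ex_cong1) auto
qed

lemma mu_eq_mu_fm:
  assumes "defined_by L G n \<phi> bs X"
  shows "mu L G n X = mu_fm G n \<phi> bs"
  unfolding mu_def
proof (rule the_equality)
  show "definable L G n X \<and> (\<forall>\<phi>' bs'. defined_by L G n \<phi>' bs' X \<longrightarrow> mu_fm G n \<phi> bs = mu_fm G n \<phi>' bs')"
    using assms mu_fm_eq unfolding definable_def by blast
qed (use assms in blast)

text \<open>The parameters are quantified inside \<open>eventually\<close>: the choice of
  \<open>d\<close> depends only on \<open>n\<close> and \<open>\<epsilon>\<close>, so one set of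
  indices \<open>k\<close> serves all parameters, as transfer demands.\<close>

lemma eventually_product_tuples:
  assumes \<phi>: "\<And>F. F \<in> index_sets n \<Longrightarrow> fv (\<phi> F) \<subseteq> {..<1 + m}" and \<epsilon>: "0 < \<epsilon>"
  shows "eventually (\<lambda>k. \<forall>bs. length bs = m \<longrightarrow> set bs \<subseteq> carrier (Gs k) \<longrightarrow>
    \<bar>real (card (solutions (Gs k) n (product_fm n m \<phi>) bs)) / real (card (carrier (Gs k))) ^ n
     - (\<Prod>F\<in>index_sets n. real (card (solutions (Gs k) 1 (\<phi> F) bs)) / real (card (carrier (Gs k))))\<bar>
    < \<epsilon>) U"
proof -
  obtain d where d: "(2 ^ n / \<epsilon>)\<^sup>2 < real d"
    using reals_Archimedean2 by blast
  moreover have "0 \<le> (2 ^ n / \<epsilon>)\<^sup>2"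
    by simp
  ultimately have d_pos: "0 < d"
    by linarith
  have "2 ^ n / \<epsilon> < sqrt (real d)"
    using d \<epsilon> by (intro real_less_rsqrt)
  then have small: "2 ^ n / sqrt (real d) < \<epsilon>"
    using \<epsilon> d_pos by (simp add: field_simps)
  have "eventually (\<lambda>k. quasirandom d (Gs k)) U"
    using uqr d_pos by (simp add: ultra_quasirandom_def)
  then show ?thesis
  proof (rule eventually_mono, intro allI impI)
    fix k bs assume quasi: "quasirandom d (Gs k)" and bs: "length bs = m" "set bs \<subseteq> carrier (Gs k)"
    let ?A = "\<lambda>F. {a. [a] \<in> solutions (Gs k) 1 (\<phi> F) bs}"
    have "?A F \<subseteq> carrier (Gs k)" for F
      by (auto dest: solutionsD)
    then have "\<bar>real (card (product_tuples (Gs k) n ?A)) / real (card (carrier (Gs k))) ^ n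
        - (\<Prod>F\<in>index_sets n. density (Gs k) (?A F))\<bar> \<le> 2 ^ n / sqrt (real d)"
      by (rule group.quasirandom_product_tuples[OF group_factor finite_factor quasi d_pos])
    moreover have "solutions (Gs k) n (product_fm n m \<phi>) bs = product_tuples (Gs k) n ?A"
      using solutions_product_fm[OF structures _ bs(2), of n \<phi>] \<phi> bs(1) by simp
    ultimately show "\<bar>real (card (solutions (Gs k) n (product_fm n m \<phi>) bs))
          / real (card (carrier (Gs k))) ^ n
        - (\<Prod>F\<in>index_sets n. real (card (solutions (Gs k) 1 (\<phi> F) bs)) / real (card (carrier (Gs k))))\<bar>
      < \<epsilon>"
      using small by (simp add: card_solutions_1[simplified] density_def)
  qed
qed

section \<open>Upper and lower estimates as implications between counting predicates\<close>

context
  fixes n :: nat and \<phi> :: "nat set \<Rightarrow> ('f, 'r) fm" and bs :: "'b list" and r :: "nat set \<Rightarrow> rat"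
  assumes \<phi>: "\<And>F. F \<in> index_sets n \<Longrightarrow> wf_fm L (\<phi> F)"
      "\<And>F. F \<in> index_sets n \<Longrightarrow> fv (\<phi> F) \<subseteq> {..<1 + length bs}"
    and bs: "set bs \<subseteq> carrier G"
    and r: "\<And>F. F \<in> index_sets n \<Longrightarrow> 0 \<le> r F"
begin

lemma counts_product_fm:
  assumes count: "\<And>F. F \<in> index_sets n \<Longrightarrow> rel_int G (QPred (r F) 1 (length bs) (\<phi> F)) bs"
    and t: "(\<Prod>F\<in>index_sets n. real_of_rat (r F)) < real_of_rat t"
  shows "rel_int G (QPred t n (length bs) (product_fm n (length bs) \<phi>)) bs"
proof -
  let ?m = "length bs" and ?I = "index_sets n"
  let ?Fs = "SOME Fs. set Fs = ?I"
  have Fs: "set ?Fs = ?I"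
    by (rule set_some_list[OF finite_index_sets])
  let ?\<theta> = "Imp (Conjs (map (\<lambda>F. counts (r F) 1 ?m (\<phi> F) 0) ?Fs))
    (counts t n ?m (product_fm n ?m \<phi>) 0)"
  have "0 \<le> (\<Prod>F\<in>?I. real_of_rat (r F))"
    using r by (intro prod_nonneg) (simp add: zero_le_of_rat_iff)
  then have "0 \<le> real_of_rat t"
    using t by linarith
  then have "0 \<le> t"
    by (simp add: zero_le_of_rat_iff)
  then have wf: "wf_fm L (counts t n ?m (product_fm n ?m \<phi>) 0)"
    "\<And>F. F \<in> ?I \<Longrightarrow> wf_fm L (counts (r F) 1 ?m (\<phi> F) 0)"
    using \<phi> r wf_product_fm[OF \<phi>(1)] fv_product_fm[OF \<phi>(2)] by (auto simp: wf_counts)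
  have "eventually (\<lambda>k. \<forall>e. range e \<subseteq> carrier (Gs k) \<longrightarrow> sat (Gs k) e ?\<theta>) U"
  proof (rule eventually_mono[OF eventually_product_tuples[OF \<phi>(2)]])
    \<comment> \<open>The gap between \<open>t\<close> and the product of the bounds is the error
      allowed in the finite groups.\<close>
    show "0 < real_of_rat t - (\<Prod>F\<in>?I. real_of_rat (r F))"
      using t by simp
  next
    fix k
    let ?N = "real (card (carrier (Gs k)))"
    let ?x = "\<lambda>F bs. real (card (solutions (Gs k) 1 (\<phi> F) bs)) / ?N"
    let ?y = "\<lambda>bs. real (card (solutions (Gs k) n (product_fm n ?m \<phi>) bs)) / ?N ^ n"
    assume approx: "\<forall>bs'. length bs' = ?m \<longrightarrow> set bs' \<subseteq> carrier (Gs k) \<longrightarrow>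
      \<bar>?y bs' - (\<Prod>F\<in>?I. ?x F bs')\<bar> < real_of_rat t - (\<Prod>F\<in>?I. real_of_rat (r F))"
    show "\<forall>e. range e \<subseteq> carrier (Gs k) \<longrightarrow> sat (Gs k) e ?\<theta>"
    proof (intro allI impI)
      fix e :: "nat \<Rightarrow> 'a" assume e: "range e \<subseteq> carrier (Gs k)"
      let ?bs = "map e [0..<?m]"
      have N: "?N > 0"
        using card_factor_pos by simp
      have "?y ?bs \<le> real_of_rat t" if "\<forall>F\<in>?I. ?x F ?bs \<le> real_of_rat (r F)"
      proof -
        have "(\<Prod>F\<in>?I. ?x F ?bs) \<le> (\<Prod>F\<in>?I. real_of_rat (r F))"
          using that by (intro prod_mono) auto
        moreover have "\<bar>?y ?bs - (\<Prod>F\<in>?I. ?x F ?bs)\<bar>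
            < real_of_rat t - (\<Prod>F\<in>?I. real_of_rat (r F))"
          by (rule approx[rule_format]) (use e in auto)
        ultimately show ?thesis
          by linarith
      qed
      then show "sat (Gs k) e ?\<theta>"
        using N sat_counts_factor[OF wf(1) e] sat_counts_factor[OF wf(2) e]
        by (simp add: sat_Conjs Fs divide_le_eq) blast
    qed
  qed
  moreover have "wf_fm L ?\<theta>"
    using wf by (simp add: wf_Conjs Fs)
  moreover obtain e where e: "range e \<subseteq> carrier G" "map e [0..<?m] = bs"
    using ex_assignment[OF bs _ carrier_G, of "[]"] by auto
  ultimately have "sat G e ?\<theta>"
    using transfer by blast
  then show ?thesis
    using count by (simp add: sat_Conjs Fs sat_counts e)
qed

text \<open>A failing predicate is a strict lower bound on a density. Since the \<open>r F\<close>
  are nonnegative, such bounds multiply, and the gap down to \<open>t\<close> absorbs the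
  error.\<close>

lemma not_counts_product_fm:
  assumes count: "\<And>F. F \<in> index_sets n \<Longrightarrow> \<not> rel_int G (QPred (r F) 1 (length bs) (\<phi> F)) bs"
    and t: "0 \<le> t" "real_of_rat t < (\<Prod>F\<in>index_sets n. real_of_rat (r F))"
  shows "\<not> rel_int G (QPred t n (length bs) (product_fm n (length bs) \<phi>)) bs"
proof -
  let ?m = "length bs" and ?I = "index_sets n"
  let ?Fs = "SOME Fs. set Fs = ?I"
  have Fs: "set ?Fs = ?I"
    by (rule set_some_list[OF finite_index_sets])
  let ?\<theta> = "Imp (Conjs (map (\<lambda>F. Neg (counts (r F) 1 ?m (\<phi> F) 0)) ?Fs))
    (Neg (counts t n ?m (product_fm n ?m \<phi>) 0))"
  have wf: "wf_fm L (counts t n ?m (product_fm n ?m \<phi>) 0)"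
    "\<And>F. F \<in> ?I \<Longrightarrow> wf_fm L (counts (r F) 1 ?m (\<phi> F) 0)"
    using \<phi> r t(1) wf_product_fm[OF \<phi>(1)] fv_product_fm[OF \<phi>(2)] by (auto simp: wf_counts)
  have "eventually (\<lambda>k. \<forall>e. range e \<subseteq> carrier (Gs k) \<longrightarrow> sat (Gs k) e ?\<theta>) U"
  proof (rule eventually_mono[OF eventually_product_tuples[OF \<phi>(2)]])
    show "0 < (\<Prod>F\<in>?I. real_of_rat (r F)) - real_of_rat t"
      using t by simp
  next
    fix k
    let ?N = "real (card (carrier (Gs k)))"
    let ?x = "\<lambda>F bs. real (card (solutions (Gs k) 1 (\<phi> F) bs)) / ?N"
    let ?y = "\<lambda>bs. real (card (solutions (Gs k) n (product_fm n ?m \<phi>) bs)) / ?N ^ n"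
    assume approx: "\<forall>bs'. length bs' = ?m \<longrightarrow> set bs' \<subseteq> carrier (Gs k) \<longrightarrow>
      \<bar>?y bs' - (\<Prod>F\<in>?I. ?x F bs')\<bar> < (\<Prod>F\<in>?I. real_of_rat (r F)) - real_of_rat t"
    show "\<forall>e. range e \<subseteq> carrier (Gs k) \<longrightarrow> sat (Gs k) e ?\<theta>"
    proof (intro allI impI)
      fix e :: "nat \<Rightarrow> 'a" assume e: "range e \<subseteq> carrier (Gs k)"
      let ?bs = "map e [0..<?m]"
      have N: "?N > 0"
        using card_factor_pos by simp
      have "real_of_rat t < ?y ?bs" if "\<forall>F\<in>?I. real_of_rat (r F) < ?x F ?bs"
      proof -
        have "(\<Prod>F\<in>?I. real_of_rat (r F)) \<le> (\<Prod>F\<in>?I. ?x F ?bs)"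
          using that r by (intro prod_mono) (auto simp: zero_le_of_rat_iff less_imp_le)
        moreover have "\<bar>?y ?bs - (\<Prod>F\<in>?I. ?x F ?bs)\<bar>
            < (\<Prod>F\<in>?I. real_of_rat (r F)) - real_of_rat t"
          by (rule approx[rule_format]) (use e in auto)
        ultimately show ?thesis
          by linarith
      qed
      then show "sat (Gs k) e ?\<theta>"
        using N sat_counts_factor[OF wf(1) e] sat_counts_factor[OF wf(2) e]
        by (simp add: sat_Conjs Fs less_divide_eq not_le) (auto simp: not_le)
    qed
  qed
  moreover have "wf_fm L ?\<theta>"
    using wf by (simp add: wf_Conjs Fs)
  moreover obtain e where e: "range e \<subseteq> carrier G" "map e [0..<?m] = bs"
    using ex_assignment[OF bs _ carrier_G, of "[]"] by auto
  ultimately have "sat G e ?\<theta>"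
    using transfer by blast
  then show ?thesis
    using count by (simp add: sat_Conjs Fs sat_counts e)
qed

end

lemma mu_fm_product_fm:
  assumes \<phi>: "\<And>F. F \<in> index_sets n \<Longrightarrow> wf_fm L (\<phi> F)"
      "\<And>F. F \<in> index_sets n \<Longrightarrow> fv (\<phi> F) \<subseteq> {..<1 + length bs}"
    and bs: "set bs \<subseteq> carrier G"
    and pos: "\<And>F. F \<in> index_sets n \<Longrightarrow> 0 < mu_fm G 1 (\<phi> F) bs"
  shows "mu_fm G n (product_fm n (length bs) \<phi>) bs = (\<Prod>F\<in>index_sets n. mu_fm G 1 (\<phi> F) bs)"
proof (rule antisym)
  let ?\<psi> = "product_fm n (length bs) \<phi>"
  have \<psi>: "wf_fm L ?\<psi>" "fv ?\<psi> \<subseteq> {..<n + length bs}" "set bs \<subseteq> carrier G"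
    using wf_product_fm[OF \<phi>(1)] fv_product_fm[OF \<phi>(2)] bs by auto
  show "mu_fm G n ?\<psi> bs \<le> (\<Prod>F\<in>index_sets n. mu_fm G 1 (\<phi> F) bs)"
  proof (rule le_prod_of_rat_above)
    fix r assume r: "\<And>F. F \<in> index_sets n \<Longrightarrow> mu_fm G 1 (\<phi> F) bs < real_of_rat (r F)"
    have r_nonneg: "0 \<le> r F" if "F \<in> index_sets n" for F
    proof -
      have "0 < real_of_rat (r F)"
        using r[OF that] pos[OF that] by linarith
      then show ?thesis
        by (simp add: zero_less_of_rat_iff)
    qed
    show "mu_fm G n ?\<psi> bs \<le> (\<Prod>F\<in>index_sets n. real_of_rat (r F))"
    proof (rule ccontr)
      assume "\<not> ?thesis"
      \<comment> \<open>A violated inequality leaves room for a rational \<open>t\<close>; the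
        transferred estimate makes its predicate hold, so the measure is at most \<open>t\<close>
        after all.\<close>
      then obtain t where t: "(\<Prod>F\<in>index_sets n. real_of_rat (r F)) < real_of_rat t"
          "real_of_rat t < mu_fm G n ?\<psi> bs"
        using rat_above by (meson not_le)
      have "0 \<le> (\<Prod>F\<in>index_sets n. real_of_rat (r F))"
        using r_nonneg by (intro prod_nonneg) (simp add: zero_le_of_rat_iff)
      then have "0 < real_of_rat t"
        using t(1) by linarith
      then have "0 \<le> t"
        by (simp add: zero_less_of_rat_iff)
      moreover have "rel_int G (QPred t n (length bs) ?\<psi>) bs"
        by (rule counts_product_fm[OF \<phi> bs r_nonneg _ t(1)])
          (auto intro!: counts_if_mu_fm_less \<phi> bs r simp flip: One_nat_def)
      ultimately show False
        using mu_fm_le[OF \<psi>] t(2) by fastforce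
    qed
  qed
  show "(\<Prod>F\<in>index_sets n. mu_fm G 1 (\<phi> F) bs) \<le> mu_fm G n ?\<psi> bs"
  proof (rule ge_prod_of_rat_below[OF pos])
    fix r assume r: "\<And>F. F \<in> index_sets n \<Longrightarrow> 0 \<le> r F \<and> real_of_rat (r F) < mu_fm G 1 (\<phi> F) bs"
    show "(\<Prod>F\<in>index_sets n. real_of_rat (r F)) \<le> mu_fm G n ?\<psi> bs"
    proof (rule ccontr)
      assume "\<not> ?thesis"
      then obtain t where t: "mu_fm G n ?\<psi> bs < real_of_rat t"
          "real_of_rat t < (\<Prod>F\<in>index_sets n. real_of_rat (r F))"
        using rat_above by (meson not_le)
      have "0 < real_of_rat t"
        using t(1) mu_fm_nonneg[OF \<psi>] by linarith
      then have "0 \<le> t"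
        by (simp add: zero_less_of_rat_iff)
      have "\<not> rel_int G (QPred (r F) 1 (length bs) (\<phi> F)) bs" if F: "F \<in> index_sets n" for F
        using mu_fm_le[OF \<phi>(1)[OF F] \<phi>(2)[OF F] bs, of "r F"] r[OF F] by fastforce
      then have "\<not> rel_int G (QPred t n (length bs) ?\<psi>) bs"
        using r by (intro not_counts_product_fm[OF \<phi> bs _ _ \<open>0 \<le> t\<close> t(2)]) auto
      then show False
        using counts_if_mu_fm_less[OF \<psi> t(1)] by blast
    qed
  qed
qed

end

theorem theorem4p7:
  fixes L :: "('f, 'r) signature"
    and U :: "nat filter"
    and Gs :: "nat \<Rightarrow> ('a, 'f, 'r) lstruct"
    and G :: "('b, 'f, 'r) lstruct"
    and n :: nat
    and A :: "nat set \<Rightarrow> 'b set"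
  assumes "ultra_quasirandom L U Gs G"
    and "2 \<le> n"
    and "\<And>F. F \<noteq> {} \<Longrightarrow> F \<subseteq> {1..n} \<Longrightarrow>
           definable L G 1 (pow1 (A F)) \<and> 0 < mu L G 1 (pow1 (A F))"
  shows "mu L G n {as. length as = n \<and> set as \<subseteq> carrier G \<and>
                       (\<forall>F. F \<noteq> {} \<and> F \<subseteq> {1..n} \<longrightarrow> index_prod G as F \<in> A F)}
         = (\<Prod>F \<in> {F. F \<noteq> {} \<and> F \<subseteq> {1..n}}. mu L G 1 (pow1 (A F)))"
proof -
  interpret ultra_quasirandom_group L U Gs G
    by unfold_locales (rule assms(1))
  have A: "definable L G 1 (pow1 (A F))" "0 < mu L G 1 (pow1 (A F))" if "F \<in> index_sets n" for F
    using assms(3) that by (auto simp: index_sets_def)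
  obtain bs \<phi> where bs: "set bs \<subseteq> carrier G"
    and \<phi>: "\<And>F. F \<in> index_sets n \<Longrightarrow> defined_by L G 1 (\<phi> F) bs (pow1 (A F))"
    using definable_common_parameters[of "index_sets n" L G 1 "\<lambda>F. pow1 (A F)"]
      finite_index_sets A(1) by blast
  have wf: "wf_fm L (\<phi> F)" and fv: "fv (\<phi> F) \<subseteq> {..<1 + length bs}"
    and sol: "solutions G 1 (\<phi> F) bs = pow1 (A F)" if "F \<in> index_sets n" for F
    using \<phi>[OF that] by (auto simp: defined_by_def)
  have mu: "mu L G 1 (pow1 (A F)) = mu_fm G 1 (\<phi> F) bs" if "F \<in> index_sets n" for F
    using \<phi>[OF that] by (rule mu_eq_mu_fm)
  have "a \<in> A F \<longleftrightarrow> [a] \<in> solutions G 1 (\<phi> F) bs" if "F \<in> index_sets n" for F a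
    unfolding sol[OF that] by (auto simp: pow1_def)
  then have "product_tuples G n A = product_tuples G n (\<lambda>F. {a. [a] \<in> solutions G 1 (\<phi> F) bs})"
    by (simp add: product_tuples_def cong: ball_cong)
  also have "\<dots> = solutions G n (product_fm n (length bs) \<phi>) bs"
    by (rule solutions_product_fm[OF structure_G fv bs, symmetric])
  \<comment> \<open>Since \<open>mu\<close> is a definite description, the set of tuples is first
    exhibited as definable; only then can its measure be read off from a formula.\<close>
  finally have "defined_by L G n (product_fm n (length bs) \<phi>) bs (product_tuples G n A)"
    using wf_product_fm[OF wf] fv_product_fm[OF fv] bs by (simp add: defined_by_def)
  then have "mu L G n (product_tuples G n A) = mu_fm G n (product_fm n (length bs) \<phi>) bs"
    by (rule mu_eq_mu_fm)
  also have "\<dots> = (\<Prod>F\<in>index_sets n. mu_fm G 1 (\<phi> F) bs)"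
    by (rule mu_fm_product_fm[OF wf fv bs]) (use A(2) mu in auto)
  also have "\<dots> = (\<Prod>F\<in>index_sets n. mu L G 1 (pow1 (A F)))"
    by (rule prod.cong[OF refl mu[symmetric]])
  finally show ?thesis
    unfolding product_tuples_def index_sets_def Ball_def mem_Collect_eq .
qed

end
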